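(* There is a (so-called universal) superfarthingale $U$ with the property that any non-degenerate prequential path $\upsilon\in(\mathcal{I}_r\times\{0,1\})^{\mathbb{N}}$ is game-random if and only if $\limsup_{n\to\infty}U(\upsilon_{1:n})<\infty$.
   Context: Let $\mathcal{X}=\{0,1\}$, $\mathbb{N}=\{1,2,\dots\}$ and $\mathbb{N}_0=\mathbb{N}\cup\{0\}$. An interval forecast is a non-empty closed interval $I\subseteq[0,1]$ (possibly a single point); $\mathcal{I}_r$ is the set of all interval forecasts with rational endpoints. For an interval forecast $I$ and $f\colon\mathcal{X}\to\mathbb{R}$, the upper expectation is $\overline{E}_I(f)=\max_{p\in I}[pf(1)+(1-p)f(0)]$. Prequential situations are the elements $v=(I_1,x_1,\dots,I_n,x_n)$ of $(\mathcal{I}_r\times\mathcal{X})^*=\bigcup_{k\in\mathbb{N}_0}(\mathcal{I}_r\times\mathcal{X})^k$, with the empty one denoted $\square$; $vI_rx$ is the concatenation of $v$ with $I_r\in\mathcal{I}_r$ and $x\in\mathcal{X}$. A prequential path is $\upsilon=(I_1,x_1,I_2,x_2,\dots)\in(\mathcal{I}_r\times\mathcal{X})^{\mathbb{N}}$; $\upsilon_{1:n}=(I_1,x_1,\dots,I_n,x_n)$. It is non-degenerate if $I_n\neq\{1-x_n\}$ for all $n\in\mathbb{N}$. A superfarthingale is a map $F\colon(\mathcal{I}_r\times\mathcal{X})^*\to\mathbb{R}$ with $\overline{E}_{I_r}(F(vI_r\,\cdot))\leq F(v)$ for all prequential situations $v$ and all $I_r\in\mathcal{I}_r$, where $F(vI_r\,\cdot)$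 is the map $x\mapsto F(vI_rx)$. A test superfarthingale is a superfarthingale $F\geq0$ with $F(\square)=1$. A map $r\colon\mathcal{D}\to\mathbb{R}$ on a countable encoded set $\mathcal{D}$ is lower semicomputable if there is a recursive (Turing-computable, via encodings) map $q\colon\mathcal{D}\times\mathbb{N}_0\to\mathbb{Q}$ with $q(d,n)\leq q(d,n+1)$ and $\lim_{m\to\infty}q(d,m)=r(d)$ for all $d,n$. A prequential path $\upsilon$ is game-random if it is non-degenerate and all lower semicomputable test superfarthingales $F$ satisfy $\limsup_{n\to\infty}F(\upsilon_{1:n})<\infty$. *)

theory Defs
  imports "HOL-Analysis.Analysis" "HOL-Library.Nat_Bijection"
begin

section \<open>Interval forecasts and upper expectations\<close>

text \<open>A rational interval forecast is stored by its two endpoints; the interval itself, as a set of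
  reals, is \<open>interval I\<close>. The outcome space \<open>{0, 1}\<close> is \<^typ>\<open>bool\<close>, with
  \<open>of_bool\<close> giving the numerical outcome.\<close>

typedef rat_forecast = "{(a :: rat, b :: rat). 0 \<le> a \<and> a \<le> b \<and> b \<le> 1}"
  morphisms endpoints Abs_rat_forecast
  by (rule exI [of _ "(0, 1)"]) simp

definition interval :: "rat_forecast \<Rightarrow> real set" where
  "interval I = {real_of_rat (fst (endpoints I)) .. real_of_rat (snd (endpoints I))}"

lemma endpoints_bounds:
  "0 \<le> fst (endpoints I)" "fst (endpoints I) \<le> snd (endpoints I)" "snd (endpoints I) \<le> 1"
  using endpoints [of I] by (auto split: prod.splits)

lemma inj_interval: "inj interval"
proof (rule injI)
  fix I J assume "interval I = interval J"
  moreover have "real_of_rat (fst (endpoints I)) \<le> real_of_rat (snd (endpoints I))"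
    by (simp add: endpoints_bounds of_rat_less_eq)
  ultimately have "endpoints I = endpoints J"
    by (simp add: interval_def prod_eq_iff)
  then show "I = J" by (simp add: endpoints_inject)
qed

lemma range_interval:
  "range interval = {{a..b} | a b :: real. a \<in> \<rat> \<and> b \<in> \<rat> \<and> 0 \<le> a \<and> a \<le> b \<and> b \<le> 1}"
proof (intro equalityI subsetI)
  fix S assume "S \<in> range interval"
  then obtain I where "S = interval I" by blast
  moreover have "0 \<le> real_of_rat (fst (endpoints I))"
    "real_of_rat (fst (endpoints I)) \<le> real_of_rat (snd (endpoints I))"
    "real_of_rat (snd (endpoints I)) \<le> 1"
    using endpoints_bounds [of I] by (simp_all add: of_rat_less_eq)
  ultimately show "S \<in> {{a..b} | a b :: real. a \<in> \<rat> \<and> b \<in> \<rat> \<and> 0 \<le> a \<and> a \<le> b \<and> b \<le> 1}"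
    unfolding interval_def using Rats_of_rat by (intro CollectI exI conjI) auto
next
  fix S assume "S \<in> {{a..b} | a b :: real. a \<in> \<rat> \<and> b \<in> \<rat> \<and> 0 \<le> a \<and> a \<le> b \<and> b \<le> 1}"
  then obtain x y :: real where xy: "S = {x..y}" "x \<in> \<rat>" "y \<in> \<rat>" "0 \<le> x" "x \<le> y" "y \<le> 1"
    by blast
  obtain a b where "x = real_of_rat a" "y = real_of_rat b"
    using xy(2,3) by (metis Rats_cases)
  with xy have ab: "S = {real_of_rat a..real_of_rat b}" "0 \<le> a" "a \<le> b" "b \<le> 1"
    by (simp_all add: of_rat_less_eq)
  then have "endpoints (Abs_rat_forecast (a, b)) = (a, b)"
    by (intro Abs_rat_forecast_inverse) auto
  then have "S = interval (Abs_rat_forecast (a, b))"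
    using ab by (simp add: interval_def)
  then show "S \<in> range interval" by blast
qed

definition upper_expectation :: "real set \<Rightarrow> (bool \<Rightarrow> real) \<Rightarrow> real" where
  "upper_expectation I f = (SUP p\<in>I. p * f True + (1 - p) * f False)"

lemma upper_expectation_attained:
  assumes "0 \<le> a" "a \<le> b" "b \<le> 1"
  shows "\<exists>p\<in>{a..b}. upper_expectation {a..b} f = p * f True + (1 - p) * f False
           \<and> (\<forall>q\<in>{a..b}. q * f True + (1 - q) * f False \<le> p * f True + (1 - p) * f False)"
proof -
  have "continuous_on {a..b} (\<lambda>p. p * f True + (1 - p) * f False)"
    by (intro continuous_intros)
  then obtain p where p: "p \<in> {a..b}"
    "\<forall>q\<in>{a..b}. q * f True + (1 - q) * f False \<le> p * f True + (1 - p) * f False"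
    using continuous_attains_sup [of "{a..b}" "\<lambda>p. p * f True + (1 - p) * f False"] assms by auto
  then have "upper_expectation {a..b} f = p * f True + (1 - p) * f False"
    unfolding upper_expectation_def by (intro cSup_eq_maximum) auto
  with p show ?thesis by blast
qed


section \<open>Prequential situations, paths and superfarthingales\<close>

type_synonym situation = "(rat_forecast \<times> bool) list"

text \<open>Paths are indexed from \<open>0\<close>: \<open>\<upsilon> n\<close> is the pair of the \<open>(n+1)\<close>-st forecast and outcome.\<close>

type_synonym path = "nat \<Rightarrow> rat_forecast \<times> bool"

definition path_prefix :: "path \<Rightarrow> nat \<Rightarrow> situation" where
  "path_prefix \<upsilon> n = map \<upsilon> [0..<n]"

definition non_degenerate :: "path \<Rightarrow> bool" where
  "non_degenerate \<upsilon> \<longleftrightarrow> (\<forall>n. interval (fst (\<upsilon> n)) \<noteq> {1 - of_bool (snd (\<upsilon> n))})"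

definition superfarthingale :: "(situation \<Rightarrow> real) \<Rightarrow> bool" where
  "superfarthingale F \<longleftrightarrow>
     (\<forall>v I. upper_expectation (interval I) (\<lambda>x. F (v @ [(I, x)])) \<le> F v)"

definition test_superfarthingale :: "(situation \<Rightarrow> real) \<Rightarrow> bool" where
  "test_superfarthingale F \<longleftrightarrow> superfarthingale F \<and> (\<forall>v. 0 \<le> F v) \<and> F [] = 1"


section \<open>Recursive maps\<close>

text \<open>Kleene's partial recursive functions, as programs acting on argument lists;
  \<open>rec_eval r xs y\<close> means that \<open>r\<close> halts on arguments \<open>xs\<close> with value \<open>y\<close>. Arities are not part
  of the syntax; on argument lists of any fixed length \<open>k\<close> the programs compute exactly the \<open>k\<close>-ary
  partial recursive functions.\<close>

datatype recf =
    Zero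
  | Succ
  | Proj nat
  | Comp recf "recf list"
  | PrimRec recf recf
  | Mu recf

inductive rec_eval :: "recf \<Rightarrow> nat list \<Rightarrow> nat \<Rightarrow> bool" where
  zero: "rec_eval Zero xs 0"
| succ: "rec_eval Succ [x] (Suc x)"
| proj: "i < length xs \<Longrightarrow> rec_eval (Proj i) xs (xs ! i)"
| comp: "list_all2 (\<lambda>g y. rec_eval g xs y) gs ys \<Longrightarrow> rec_eval f ys z \<Longrightarrow> rec_eval (Comp f gs) xs z"
| primrec_0: "rec_eval f xs y \<Longrightarrow> rec_eval (PrimRec f g) (0 # xs) y"
| primrec_Suc: "rec_eval (PrimRec f g) (n # xs) y \<Longrightarrow> rec_eval g (n # y # xs) z \<Longrightarrow>
    rec_eval (PrimRec f g) (Suc n # xs) z"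
| mu: "rec_eval f (n # xs) 0 \<Longrightarrow> (\<forall>i<n. \<exists>y. rec_eval f (i # xs) (Suc y)) \<Longrightarrow>
    rec_eval (Mu f) xs n"

inductive_cases rec_eval_elims:
  "rec_eval Zero xs z"
  "rec_eval Succ xs z"
  "rec_eval (Proj i) xs z"
  "rec_eval (Comp f gs) xs z"
  "rec_eval (PrimRec f g) (0 # xs) z"
  "rec_eval (PrimRec f g) (Suc n # xs) z"
  "rec_eval (Mu f) xs z"

lemma rec_eval_deterministic: "rec_eval r xs y \<Longrightarrow> rec_eval r xs z \<Longrightarrow> y = z"
proof (induction arbitrary: z rule: rec_eval.induct)
  case (zero xs)
  then show ?case by (rule rec_eval_elims(1)) simp
next
  case (succ x)
  then show ?case by (rule rec_eval_elims(2)) simp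
next
  case (proj i xs)
  from proj(2) show ?case by (rule rec_eval_elims(3)) simp
next
  case (comp xs gs ys f w)
  from comp.prems obtain ys' where
    ys': "list_all2 (\<lambda>g y. rec_eval g xs y) gs ys'" "rec_eval f ys' z"
    by (rule rec_eval_elims(4))
  have "ys ! i = ys' ! i" if "i < length gs" for i
    using comp.IH(1) ys'(1) that by (simp add: list_all2_conv_all_nth)
  then have "ys = ys'"
    using comp.IH(1) ys'(1) by (intro nth_equalityI) (auto simp: list_all2_conv_all_nth)
  then show ?case using comp.IH(2) ys'(2) by simp
next
  case (primrec_0 f xs y g)
  from primrec_0.prems have "rec_eval f xs z" by (rule rec_eval_elims(5))
  then show ?case by (rule primrec_0.IH)
next
  case (primrec_Suc f g n xs y w)
  from primrec_Suc.prems obtain y' where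
    y': "rec_eval (PrimRec f g) (n # xs) y'" "rec_eval g (n # y' # xs) z"
    by (rule rec_eval_elims(6))
  from primrec_Suc.IH(1) [OF y'(1)] y'(2) have "rec_eval g (n # y # xs) z" by simp
  then show ?case by (rule primrec_Suc.IH(2))
next
  case (mu f n xs)
  from mu.prems have z: "rec_eval f (z # xs) 0" "\<forall>i<z. \<exists>y. rec_eval f (i # xs) (Suc y)"
    by (rule rec_eval_elims(7); simp)+
  have "\<not> n < z"
    using mu.IH(1) z(2) by (metis nat.distinct(1))
  moreover have "\<not> z < n"
    using mu.IH(2) z(1) by (metis nat.distinct(1))
  ultimately show ?case by simp
qed

text \<open>Encodings are explicit, since an arbitrary injection into \<^typ>\<open>nat\<close> need not be effective.
  Rationals are encoded by numerator and denominator in lowest terms.\<close>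

definition rat_encode :: "rat \<Rightarrow> nat" where
  "rat_encode q =
     prod_encode (int_encode (fst (quotient_of q)), nat (snd (quotient_of q)))"

definition step_encode :: "rat_forecast \<times> bool \<Rightarrow> nat" where
  "step_encode s =
     prod_encode (prod_encode (rat_encode (fst (endpoints (fst s))),
                               rat_encode (snd (endpoints (fst s)))),
                  of_bool (snd s))"

definition situation_encode :: "situation \<Rightarrow> nat" where
  "situation_encode v = list_encode (map step_encode v)"

lemma inj_rat_encode: "inj rat_encode"
proof (rule injI)
  fix p q assume "rat_encode p = rat_encode q"
  then have "quotient_of p = quotient_of q"
    using quotient_of_denom_pos' [of p] quotient_of_denom_pos' [of q]
    by (simp add: rat_encode_def prod_eq_iff int_encode_eq eq_nat_nat_iff)
  then show "p = q" by (simp add: quotient_of_inject)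
qed

lemma inj_step_encode: "inj step_encode"
proof (rule injI)
  fix s t assume "step_encode s = step_encode t"
  then have "endpoints (fst s) = endpoints (fst t)" and "snd s = snd t"
    by (simp_all add: step_encode_def inj_eq [OF inj_rat_encode] of_bool_eq_iff prod_eqI)
  then show "s = t"
    by (simp add: endpoints_inject prod_eqI)
qed

lemma inj_situation_encode: "inj situation_encode"
  by (rule injI) (simp add: situation_encode_def list_encode_eq inj_map_eq_map [OF inj_step_encode])

definition recursive_map :: "('d \<Rightarrow> nat) \<Rightarrow> ('d \<Rightarrow> nat \<Rightarrow> rat) \<Rightarrow> bool" where
  "recursive_map enc q \<longleftrightarrow> (\<exists>r. \<forall>d n. rec_eval r [enc d, n] (rat_encode (q d n)))"

definition lower_semicomputable :: "('d \<Rightarrow> nat) \<Rightarrow> ('d \<Rightarrow> real) \<Rightarrow> bool" where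
  "lower_semicomputable enc f \<longleftrightarrow>
     (\<exists>q. recursive_map enc q \<and> (\<forall>d n. q d n \<le> q d (Suc n))
        \<and> (\<forall>d. (\<lambda>m. real_of_rat (q d m)) \<longlonglongrightarrow> f d))"


section \<open>Game-randomness\<close>

definition game_random :: "path \<Rightarrow> bool" where
  "game_random \<upsilon> \<longleftrightarrow> non_degenerate \<upsilon> \<and>
     (\<forall>F. lower_semicomputable situation_encode F \<and> test_superfarthingale F \<longrightarrow>
        limsup (\<lambda>n. ereal (F (path_prefix \<upsilon> n))) < \<infinity>)"

end

theory Submission
  imports Defs
begin


text \<open>
  Every program \<open>e\<close> is run in parallel on all arguments and for growing numbers of steps; the running
  maximum of its outputs is an increasing sequence \<open>A\<^sub>k\<close> of rational maps that converges to \<open>F\<close> if \<open>e\<close>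
  witnesses that \<open>F \<ge> 0\<close> is lower semicomputable. From \<open>Q\<^sub>k = (1 - 2\<^sup>-\<^sup>k) A\<^sub>k\<close> one obtains a
  test superfarthingale \<open>G\<^sub>s\<close> top-down: \<open>G\<^sub>s\<close> is \<open>1\<close> at the root, and at the children \<open>v I x\<close> of \<open>v\<close> it is
  \<open>Q\<^sub>k\<close> for the last \<open>k < s\<close> for which the upper expectation of \<open>Q\<^sub>k\<close> under \<open>I\<close> does not exceed \<open>G\<^sub>s v\<close>.
  These \<open>G\<^sub>s\<close> increase with \<open>s\<close>, whatever \<open>e\<close> is, and they converge to \<open>F\<close> on situations without
  impossible outcomes if \<open>F\<close> is a test superfarthingale, because the factor \<open>1 - 2\<^sup>-\<^sup>k\<close> leaves room for the
  error at the parent. Setting them to \<open>0\<close> after an impossible outcome keeps them bounded at each situation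
  uniformly in \<open>e\<close>, so that the mixture with weights \<open>2\<^sup>-\<^sup>e\<^sup>-\<^sup>1\<close> is a lower semicomputable test
  superfarthingale that dominates all others up to constants along non-degenerate paths.
\<close>

section \<open>Programs for the pairing function\<close>

lemma rec_eval_Comp1:
  "rec_eval g xs a \<Longrightarrow> rec_eval f [a] z \<Longrightarrow> rec_eval (Comp f [g]) xs z"
  by (rule rec_eval.comp [where ys = "[a]"]) simp_all

lemma rec_eval_Comp2:
  "rec_eval g xs a \<Longrightarrow> rec_eval h xs b \<Longrightarrow> rec_eval f [a, b] z \<Longrightarrow> rec_eval (Comp f [g, h]) xs z"
  by (rule rec_eval.comp [where ys = "[a, b]"]) simp_all

lemma rec_eval_Proj: "i < length xs \<Longrightarrow> y = xs ! i \<Longrightarrow> rec_eval (Proj i) xs y"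
  by (simp add: rec_eval.proj)

lemmas rec_eval_intros = rec_eval.zero rec_eval.succ rec_eval_Comp1 rec_eval_Comp2 rec_eval_Proj

definition add_prog :: recf where
  "add_prog = PrimRec (Proj 0) (Comp Succ [Proj 1])"

lemma add_prog: "rec_eval add_prog [m, n] (m + n)"
  unfolding add_prog_def
  by (induction m) (auto intro!: rec_eval.primrec_0 rec_eval_intros intro: rec_eval.primrec_Suc)

definition pred_prog :: recf where
  "pred_prog = PrimRec Zero (Proj 0)"

lemma pred_prog: "rec_eval pred_prog [n] (n - 1)"
  unfolding pred_prog_def
  by (induction n) (auto intro!: rec_eval.primrec_0 rec_eval_intros intro: rec_eval.primrec_Suc)

text \<open>The recursion runs on the first argument, so the first argument is subtracted from the
  second.\<close>

definition diff_prog :: recf where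
  "diff_prog = PrimRec (Proj 0) (Comp pred_prog [Proj 1])"

lemma diff_prog: "rec_eval diff_prog [m, n] (n - m)"
proof (induction m)
  case (Suc m)
  have "rec_eval pred_prog [n - m] (n - Suc m)"
    using pred_prog [of "n - m"] by simp
  with Suc show ?case
    unfolding diff_prog_def by (auto intro!: rec_eval_intros intro: rec_eval.primrec_Suc)
qed (auto simp: diff_prog_def intro!: rec_eval.primrec_0 rec_eval_intros)

definition triangle_prog :: recf where
  "triangle_prog = PrimRec Zero (Comp add_prog [Proj 1, Comp Succ [Proj 0]])"

lemma triangle_prog: "rec_eval triangle_prog [n] (triangle n)"
proof (induction n)
  case (Suc n)
  have "rec_eval add_prog [triangle n, Suc n] (triangle (Suc n))"
    using add_prog [of "triangle n" "Suc n"] by simp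
  with Suc show ?case
    unfolding triangle_prog_def by (auto intro!: rec_eval_intros intro: rec_eval.primrec_Suc)
qed (auto simp: triangle_prog_def intro!: rec_eval.primrec_0 rec_eval_intros)

definition pair_prog :: recf where
  "pair_prog = Comp add_prog [Comp triangle_prog [Comp add_prog [Proj 0, Proj 1]], Proj 0]"

lemma pair_prog: "rec_eval pair_prog [m, n] (prod_encode (m, n))"
  unfolding pair_prog_def prod_encode_def
  by (rule rec_eval_intros add_prog triangle_prog | simp)+

text \<open>The diagonal of the pairing on which \<open>k\<close> lies: the least \<open>d\<close> with \<open>k < triangle (d + 1)\<close>.\<close>

definition diagonal_prog :: recf where
  "diagonal_prog = Mu (Comp diff_prog [Comp triangle_prog [Comp Succ [Proj 0]], Comp Succ [Proj 1]])"

lemma diagonal_prog: "rec_eval diagonal_prog [prod_encode (m, n)] (m + n)"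
proof -
  let ?k = "prod_encode (m, n)"
  \<comment> \<open>Truncated subtraction gives \<open>0\<close> exactly if
    \<open>k < triangle (Suc d)\<close>, which is the condition that \<open>Mu\<close> has to
    detect.\<close>
  have eval: "rec_eval (Comp diff_prog [Comp triangle_prog [Comp Succ [Proj 0]], Comp Succ [Proj 1]])
      [d, k] (Suc k - triangle (Suc d))" for d k
    by (rule rec_eval_intros diff_prog triangle_prog | simp)+
  have mono: "triangle i \<le> triangle j" if "i \<le> j" for i j
    using that by (induction rule: dec_induct) auto
  have "Suc ?k - triangle (Suc (m + n)) = 0"
    by (simp add: prod_encode_def)
  moreover have "\<exists>y. Suc ?k - triangle (Suc i) = Suc y" if "i < m + n" for i
    using mono [of "Suc i" "m + n"] that
    by (intro exI [of _ "?k - triangle (Suc i)"]) (auto simp: prod_encode_def)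
  ultimately show ?thesis
    unfolding diagonal_prog_def using eval by (metis rec_eval.mu)
qed

definition fst_prog :: recf where
  "fst_prog = Comp diff_prog [Comp triangle_prog [diagonal_prog], Proj 0]"

lemma fst_prog: "rec_eval fst_prog [prod_encode (m, n)] m"
proof -
  have "rec_eval diff_prog [triangle (m + n), prod_encode (m, n)] m"
    using diff_prog [of "triangle (m + n)" "prod_encode (m, n)"] by (simp add: prod_encode_def)
  then show ?thesis
    unfolding fst_prog_def
    by - (rule rec_eval_intros diagonal_prog triangle_prog | simp | assumption)+
qed

definition snd_prog :: recf where
  "snd_prog = Comp diff_prog [fst_prog, diagonal_prog]"

lemma snd_prog: "rec_eval snd_prog [prod_encode (m, n)] n"
proof -
  have "rec_eval diff_prog [m, m + n] n"
    using diff_prog [of m "m + n"] by simp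
  then show ?thesis
    unfolding snd_prog_def by - (rule rec_eval_intros diagonal_prog fst_prog | simp | assumption)+
qed

section \<open>Computable maps between encoded types\<close>

class encodable =
  fixes encode :: "'a \<Rightarrow> nat"

instantiation nat :: encodable
begin
definition encode_nat :: "nat \<Rightarrow> nat" where "encode_nat n = n"
instance ..
end

instantiation bool :: encodable
begin
definition encode_bool :: "bool \<Rightarrow> nat" where "encode_bool b = of_bool b"
instance ..
end

instantiation prod :: (encodable, encodable) encodable
begin
definition encode_prod :: "'a \<times> 'b \<Rightarrow> nat" where
  "encode_prod p = prod_encode (encode (fst p), encode (snd p))"
instance ..
end

instantiation list :: (encodable) encodable
begin
definition encode_list :: "'a list \<Rightarrow> nat" where "encode_list xs = list_encode (map encode xs)"
instance ..
end

instantiation int :: encodable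
begin
definition encode_int :: "int \<Rightarrow> nat" where "encode_int = int_encode"
instance ..
end

instantiation rat :: encodable
begin
definition encode_rat :: "rat \<Rightarrow> nat" where "encode_rat = rat_encode"
instance ..
end

instantiation rat_forecast :: encodable
begin
definition encode_rat_forecast :: "rat_forecast \<Rightarrow> nat" where
  "encode_rat_forecast I = encode (endpoints I)"
instance ..
end

text \<open>The instances above are chosen so that this holds; it links \<open>computable\<close> to
  the encoding in \<open>lower_semicomputable\<close>.\<close>

lemma encode_situation: "encode (v :: situation) = situation_encode v"
proof -
  have "encode = step_encode"
    by (auto simp: step_encode_def encode_prod_def encode_rat_forecast_def encode_bool_def encode_rat_def)
  then show ?thesis by (simp add: situation_encode_def encode_list_def)
qed

text \<open>Programs get a single code. Maps of several arguments are treated as maps on nested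
  pairs, so the closure lemmas below can be chained mechanically.\<close>

definition computable :: "('a :: encodable \<Rightarrow> 'b :: encodable) \<Rightarrow> bool" where
  "computable f \<longleftrightarrow> (\<exists>r. \<forall>x. rec_eval r [encode x] (encode (f x)))"

lemma computableI: "(\<And>x. rec_eval r [encode x] (encode (f x))) \<Longrightarrow> computable f"
  unfolding computable_def by blast

text \<open>Covers all maps that only change the type in which a code is read.\<close>

lemma computable_same_code:
  assumes "computable f" "\<And>x. encode (f x) = encode (g x)"
  shows "computable g"
  using assms unfolding computable_def by simp

lemma computable_id: "computable (\<lambda>x. x)"
  by (rule computableI [of "Proj 0"]) (simp add: rec_eval_Proj)

lemma computable_compose:
  assumes "computable f" "computable g"
  shows "computable (\<lambda>x. f (g x))"
  using assms unfolding computable_def by (metis rec_eval_Comp1)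

lemma computable_const: "computable (\<lambda>_. c)"
proof -
  have "\<exists>r. \<forall>x. rec_eval r [x] n" for n
  proof (induction n)
    case 0
    then show ?case using rec_eval.zero by blast
  next
    case (Suc n)
    then show ?case by (metis rec_eval_Comp1 rec_eval.succ)
  qed
  then show ?thesis unfolding computable_def by metis
qed

lemma computable_Pair:
  assumes "computable f" "computable g"
  shows "computable (\<lambda>x. (f x, g x))"
proof -
  obtain rf rg where "\<And>x. rec_eval rf [encode x] (encode (f x))"
    "\<And>x. rec_eval rg [encode x] (encode (g x))"
    using assms unfolding computable_def by blast
  then show ?thesis
    by (intro computableI [of "Comp pair_prog [rf, rg]"])
      (auto simp: encode_prod_def intro: rec_eval_Comp2 pair_prog)
qed

lemma computable_fst: "computable f \<Longrightarrow> computable (\<lambda>x. fst (f x))"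
  by (rule computable_compose [of fst], rule computableI [of fst_prog])
    (auto simp: encode_prod_def fst_prog)

lemma computable_snd: "computable f \<Longrightarrow> computable (\<lambda>x. snd (f x))"
  by (rule computable_compose [of snd], rule computableI [of snd_prog])
    (auto simp: encode_prod_def snd_prog)

lemma computable_Suc: "computable f \<Longrightarrow> computable (\<lambda>x. Suc (f x))"
  by (rule computable_compose [of Suc], rule computableI [of Succ])
    (auto simp: encode_nat_def rec_eval.succ)

text \<open>\<open>PrimRec\<close> carries the code of the parameter \<open>x\<close> along
  unchanged; the step repacks its three arguments into the code of the triple
  \<open>(n, y, x)\<close>.\<close>

lemma computable_rec_nat:
  fixes a :: "'a :: encodable \<Rightarrow> 'b :: encodable"
  assumes "computable a" "computable (\<lambda>z. g (fst z) (fst (snd z)) (snd (snd z)))" "computable k"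
  shows "computable (\<lambda>x. rec_nat (a x) (\<lambda>n y. g n y x) (k x))"
proof -
  obtain ra rg rk where ra: "\<And>x. rec_eval ra [encode x] (encode (a x))"
    and rg: "\<And>z. rec_eval rg [encode z] (encode (g (fst z) (fst (snd z)) (snd (snd z))))"
    and rk: "\<And>x. rec_eval rk [encode x] (encode (k x))"
    using assms unfolding computable_def by blast
  let ?step = "Comp rg [Comp pair_prog [Proj 0, Comp pair_prog [Proj 1, Proj 2]]]"
  have step: "rec_eval ?step [n, encode y, encode x] (encode (g n y x))" for n y x
    using rg [of "(n, y, x)"]
    by (intro rec_eval_Comp1 [where a = "encode (n, y, x)"])
      (auto simp: encode_prod_def encode_nat_def intro!: rec_eval_Comp2 pair_prog rec_eval_Proj)
  have "rec_eval (PrimRec ra ?step) [n, encode x] (encode (rec_nat (a x) (\<lambda>n y. g n y x) n))" for n x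
    by (induction n) (simp_all add: ra rec_eval.primrec_0 rec_eval.primrec_Suc [OF _ step] del: One_nat_def)
  then show ?thesis
    by (intro computableI [of "Comp (PrimRec ra ?step) [rk, Proj 0]"] rec_eval_Comp2)
      (auto intro!: rec_eval_Proj rk [unfolded encode_nat_def])
qed

lemma computable_Least:
  fixes P :: "nat \<Rightarrow> 'a :: encodable \<Rightarrow> bool"
  assumes "computable (\<lambda>z. P (fst z) (snd z))" "\<And>x. \<exists>n. P n x"
  shows "computable (\<lambda>x. LEAST n. P n x)"
proof -
  \<comment> \<open>\<open>Mu\<close> searches for a zero, so the test is negated before it is
    turned into a number.\<close>
  have "computable (\<lambda>z. of_bool (\<not> P (fst z) (snd z)) :: nat)"
  proof -
    have c: "computable (\<lambda>z. of_bool (P (fst z) (snd z)) :: nat)"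
      by (rule computable_same_code [OF assms(1)]) (simp add: encode_bool_def encode_nat_def)
    have "computable (\<lambda>z. rec_nat (1 :: nat) (\<lambda>_ _. 0) (of_bool (P (fst z) (snd z))))"
      by (intro computable_rec_nat computable_const c)
    moreover have "rec_nat (1 :: nat) (\<lambda>_ _. 0) (of_bool b) = of_bool (\<not> b)" for b
      by (cases b) auto
    ultimately show ?thesis by simp
  qed
  then obtain r where r: "\<And>z. rec_eval r [encode z] (of_bool (\<not> P (fst z) (snd z)))"
    unfolding computable_def encode_nat_def by blast
  let ?r = "Comp r [Comp pair_prog [Proj 0, Proj 1]]"
  have eval: "rec_eval ?r [n, encode x] (of_bool (\<not> P n x))" for n x
    using r [of "(n, x)"]
    by (intro rec_eval_Comp1 [where a = "encode (n, x)"])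
      (auto simp: encode_prod_def encode_nat_def intro!: rec_eval_Comp2 pair_prog rec_eval_Proj)
  have "rec_eval (Mu ?r) [encode x] (LEAST n. P n x)" for x
  proof (rule rec_eval.mu)
    have "P (LEAST n. P n x) x"
      using assms(2) [of x] by (rule LeastI_ex)
    then show "rec_eval ?r [LEAST n. P n x, encode x] 0"
      using eval [of "LEAST n. P n x" x] by simp
    show "\<forall>i<LEAST n. P n x. \<exists>y. rec_eval ?r [i, encode x] (Suc y)"
    proof (intro allI impI)
      fix i assume "i < (LEAST n. P n x)"
      then have "\<not> P i x" by (rule not_less_Least)
      then show "\<exists>y. rec_eval ?r [i, encode x] (Suc y)"
        using eval [of i x] by auto
    qed
  qed
  then show ?thesis by (intro computableI) (auto simp: encode_nat_def)
qed


section \<open>Case distinctions, tests and arithmetic on natural numbers\<close>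

lemma computable_compose2:
  "computable (\<lambda>z. f (fst z) (snd z)) \<Longrightarrow> computable g \<Longrightarrow> computable h \<Longrightarrow> computable (\<lambda>x. f (g x) (h x))"
  using computable_compose [of "\<lambda>z. f (fst z) (snd z)" "\<lambda>x. (g x, h x)"] computable_Pair by auto

lemma computable_of_bool: "computable b \<Longrightarrow> computable (\<lambda>x. of_bool (b x) :: nat)"
  by (rule computable_same_code [of b]) (simp_all add: encode_bool_def encode_nat_def)

text \<open>Recursion over the 0/1 code of the condition executes its step not at all or exactly
  once.\<close>

lemma computable_If:
  assumes "computable b" "computable f" "computable g"
  shows "computable (\<lambda>x. if b x then f x else g x)"
proof -
  have "computable (\<lambda>x. rec_nat (g x) (\<lambda>_ _. f x) (of_bool (b x)))"
    by (intro computable_rec_nat computable_of_bool assms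
        computable_compose [OF assms(2)] computable_snd computable_id)
  moreover have "rec_nat (g x) (\<lambda>_ _. f x) (of_bool (b x)) = (if b x then f x else g x)" for x
    by simp
  ultimately show ?thesis by simp
qed

lemmas computable_basic = computable_id computable_const computable_Pair computable_fst
  computable_snd computable_Suc computable_If

lemma computable_conj: "computable b \<Longrightarrow> computable c \<Longrightarrow> computable (\<lambda>x. b x \<and> c x)"
  by (rule computable_same_code [OF computable_If [of b c "\<lambda>_. False"]])
    (simp_all add: computable_const)

lemma computable_not: "computable b \<Longrightarrow> computable (\<lambda>x. \<not> b x)"
  by (rule computable_same_code [OF computable_If [of b "\<lambda>_. False" "\<lambda>_. True"]])
    (simp_all add: computable_const)

lemma computable_add_nat:
  assumes "computable f" "computable g"
  shows "computable (\<lambda>x. f x + g x :: nat)"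
proof -
  have "computable (\<lambda>x. rec_nat (f x) (\<lambda>_ y. Suc y) (g x))"
    by (intro computable_rec_nat computable_basic assms)
  moreover have "rec_nat m (\<lambda>_ y. Suc y) n = m + n" for m n by (induction n) auto
  ultimately show ?thesis by simp
qed

lemma computable_mult_nat:
  assumes "computable f" "computable g"
  shows "computable (\<lambda>x. f x * g x :: nat)"
proof -
  have "computable (\<lambda>x. rec_nat 0 (\<lambda>_ y. f x + y) (g x))"
    by (intro computable_rec_nat computable_basic computable_add_nat
        computable_compose [OF assms(1)] assms)
  moreover have "rec_nat 0 (\<lambda>_ y. m + y) n = m * n" for m n :: nat by (induction n) auto
  ultimately show ?thesis by simp
qed

lemma computable_diff_nat:
  assumes "computable f" "computable g"
  shows "computable (\<lambda>x. f x - g x :: nat)"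
proof -
  have pred: "computable (\<lambda>x. k x - 1)" if "computable k" for k :: "'b :: encodable \<Rightarrow> nat"
  proof -
    have "computable (\<lambda>x. rec_nat (0 :: nat) (\<lambda>n _. n) (k x))"
      by (intro computable_rec_nat computable_basic that)
    moreover have "rec_nat (0 :: nat) (\<lambda>n _. n) n = n - 1" for n by (cases n) auto
    ultimately show ?thesis by simp
  qed
  have "computable (\<lambda>x. rec_nat (f x) (\<lambda>_ y. y - 1) (g x))"
    by (intro computable_rec_nat pred computable_basic assms)
  moreover have "rec_nat m (\<lambda>_ y. y - 1) n = m - n" for m n :: nat by (induction n) auto
  ultimately show ?thesis by simp
qed

lemma computable_is_0:
  assumes "computable f"
  shows "computable (\<lambda>x. f x = (0 :: nat))"
proof -
  have "computable (\<lambda>x. rec_nat True (\<lambda>_ _. False) (f x))"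
    by (intro computable_rec_nat computable_basic assms)
  moreover have "rec_nat True (\<lambda>_ _. False) n = (n = 0)" for n by (cases n) auto
  ultimately show ?thesis by simp
qed

lemma computable_le_nat:
  "computable f \<Longrightarrow> computable g \<Longrightarrow> computable (\<lambda>x. f x \<le> (g x :: nat))"
  using computable_is_0 [OF computable_diff_nat, of f g] by simp

lemma computable_eq_nat:
  assumes "computable f" "computable g"
  shows "computable (\<lambda>x. f x = (g x :: nat))"
  using computable_conj [OF computable_le_nat computable_le_nat, OF assms assms(2,1)]
  by (simp add: eq_iff)

lemmas computable_nat = computable_basic computable_conj computable_not computable_add_nat
  computable_mult_nat computable_diff_nat computable_le_nat computable_eq_nat

section \<open>Lists\<close>

lemma encode_list_simps [simp]:
  "encode ([] :: 'a :: encodable list) = 0"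
  "encode (x # xs) = Suc (prod_encode (encode x, encode xs))"
  by (simp_all add: encode_list_def)

lemma computable_Nil_iff:
  fixes f :: "'a :: encodable \<Rightarrow> 'b :: encodable list"
  assumes "computable f"
  shows "computable (\<lambda>x. f x = [])"
proof -
  have "computable (\<lambda>x. encode (f x))"
    by (rule computable_same_code [OF assms]) (simp add: encode_nat_def)
  from computable_is_0 [OF this] show ?thesis
    by (rule computable_same_code) (case_tac "f x", simp_all)
qed

lemma computable_Cons:
  assumes "computable f" "computable g"
  shows "computable (\<lambda>x. f x # g x)"
proof -
  have "computable (\<lambda>x. prod_encode (encode (f x), encode (g x)))"
    by (rule computable_same_code [OF computable_Pair [OF assms]])
      (simp add: encode_nat_def encode_prod_def)
  from computable_Suc [OF this] show ?thesis
    by (rule computable_same_code) (simp add: encode_nat_def)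
qed

lemma computable_prod_decode: "computable f \<Longrightarrow> computable (\<lambda>x. prod_decode (f x))"
  by (erule computable_same_code) (simp add: encode_nat_def encode_prod_def)

text \<open>For \<^const>\<open>hd\<close> the code of the unspecified value \<open>hd []\<close> is hard-wired into the program.\<close>

lemma computable_hd_tl:
  fixes f :: "'a :: encodable \<Rightarrow> 'b :: encodable list"
  assumes "computable f"
  shows "computable (\<lambda>x. hd (f x))" "computable (\<lambda>x. tl (f x))"
proof -
  have code: "computable (\<lambda>x. encode (f x))"
    by (rule computable_same_code [OF assms]) (simp add: encode_nat_def)
  have "computable (\<lambda>x. if encode (f x) = 0 then encode (hd ([] :: 'b list))
      else fst (prod_decode (encode (f x) - 1)))"
    by (intro computable_nat computable_prod_decode code)
  then show "computable (\<lambda>x. hd (f x))"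
    by (rule computable_same_code) (case_tac "f x", simp_all add: encode_nat_def)
  have "computable (\<lambda>x. if encode (f x) = 0 then 0 else snd (prod_decode (encode (f x) - 1)))"
    by (intro computable_nat computable_prod_decode code)
  then show "computable (\<lambda>x. tl (f x))"
    by (rule computable_same_code) (case_tac "f x", simp_all add: encode_nat_def)
qed

lemma length_le_encode: "length xs \<le> encode (xs :: 'a :: encodable list)"
proof (induction xs)
  case (Cons x xs)
  then show ?case using le_prod_encode_2 [of "encode xs" "encode x"] by simp
qed simp

text \<open>The code of a list bounds its length, so it can serve as the iteration count.\<close>

lemma computable_foldl:
  fixes l :: "'a :: encodable \<Rightarrow> 'b :: encodable list" and a :: "'a \<Rightarrow> 'c :: encodable"
  assumes "computable (\<lambda>z. g (fst z) (fst (snd z)) (snd (snd z)))" "computable a" "computable l"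
  shows "computable (\<lambda>x. foldl (\<lambda>y b. g y b x) (a x) (l x))"
proof -
  define step where
    "step x s = (if fst s = [] then s else (tl (fst s), g (snd s) (hd (fst s)) x))" for x and s :: "'b list \<times> 'c"
  define run where "run x = rec_nat (l x, a x) (\<lambda>_ s. step x s) (encode (l x))" for x
  have g: "computable (\<lambda>x. g (f x) (h x) (k x))" if "computable f" "computable h" "computable k"
    for f h and k :: "'d :: encodable \<Rightarrow> 'a"
    using computable_compose [OF assms(1) computable_Pair [OF that(1) computable_Pair [OF that(2,3)]]]
    by simp
  have code: "computable (\<lambda>x. encode (l x))"
    by (rule computable_same_code [OF assms(3)]) (simp add: encode_nat_def)
  have "computable (\<lambda>x. snd (run x))"
    unfolding run_def step_def
    by (intro computable_rec_nat computable_nat computable_Nil_iff computable_hd_tl g assms code)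
  moreover have "snd (rec_nat (ys, b) (\<lambda>_ s. step x s) n) = foldl (\<lambda>y b. g y b x) b ys"
    if "length ys \<le> n" for x ys b n
  proof -
    \<comment> \<open>\<open>foldl\<close> consumes the list from the front, whereas
      \<open>rec_nat\<close> unfolds its last step; this moves the first step to the initial
      state.\<close>
    have shift: "rec_nat s (\<lambda>_ s. step x s) (Suc n) = rec_nat (step x s) (\<lambda>_ s. step x s) n" for s n
      by (induction n) auto
    \<comment> \<open>Iterations beyond the length of the list leave the state unchanged.\<close>
    have stop: "rec_nat ([], b) (\<lambda>_ s. step x s) n = ([], b)" for b n
      by (induction n) (auto simp: step_def)
    show ?thesis
      using that
    proof (induction n arbitrary: ys b)
      case (Suc n)
      note IH = Suc.IH and le = Suc.prems
      show ?case
      proof (cases ys)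
        case Nil
        then show ?thesis by (simp add: stop del: nat.rec(2))
      next
        case (Cons c zs)
        then have "step x (ys, b) = (zs, g b c x)" by (simp add: step_def)
        with IH [of zs "g b c x"] le Cons show ?thesis by (simp add: shift del: nat.rec(2))
      qed
    qed simp
  qed
  ultimately show ?thesis by (simp add: run_def length_le_encode)
qed

text \<open>Pushing the elements of \<open>f x\<close> onto an empty list reverses them; pushing the
  result onto \<open>g x\<close> restores their order.\<close>

lemma computable_append:
  fixes f g :: "'a :: encodable \<Rightarrow> 'b :: encodable list"
  assumes "computable f" "computable g"
  shows "computable (\<lambda>x. f x @ g x)"
proof -
  have prepend: "foldl (\<lambda>ys y. y # ys) b xs = rev xs @ b" for b xs :: "'b list"
    by (induction xs arbitrary: b) auto
  have "computable (\<lambda>x. foldl (\<lambda>ys y. y # ys) (g x) (foldl (\<lambda>ys y. y # ys) [] (f x)))"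
    by (intro computable_foldl computable_Cons computable_basic assms)
  then show ?thesis by (simp add: prepend)
qed

lemma computable_drop:
  assumes "computable f" "computable n"
  shows "computable (\<lambda>x. drop (n x) (f x))"
proof -
  have "computable (\<lambda>x. rec_nat (f x) (\<lambda>_ ys. tl ys) (n x))"
    by (intro computable_rec_nat computable_hd_tl computable_basic assms)
  moreover have "rec_nat xs (\<lambda>_ ys. tl ys) n = drop n xs" for xs :: "'c list" and n
    by (induction n) (auto simp: drop_Suc tl_drop)
  then have "(\<lambda>x. rec_nat (f x) (\<lambda>_ ys. tl ys) (n x)) = (\<lambda>x. drop (n x) (f x))" by blast
  ultimately show ?thesis by simp
qed

lemmas computable_list = computable_nat computable_Nil_iff computable_Cons computable_hd_tl
  computable_append computable_drop computable_prod_decode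


section \<open>Rational arithmetic\<close>

text \<open>The code of \<open>i\<close> is \<open>2 * i\<close> for \<open>i \<ge> 0\<close> and
  \<open>- 2 * i - 1\<close> otherwise. Half of it, rounded up, is the absolute value, and its
  parity gives the sign.\<close>

lemma computable_nat_of_int:
  assumes "computable f"
  shows "computable (\<lambda>x. nat (f x))" "computable (\<lambda>x. nat (- f x))"
proof -
  have code: "computable (\<lambda>x. int_encode (f x))"
    by (rule computable_same_code [OF assms]) (simp add: encode_nat_def encode_int_def)
  let ?half = "\<lambda>x. LEAST n. int_encode (f x) \<le> 2 * n"
  have half: "computable ?half"
  proof (rule computable_Least)
    show "computable (\<lambda>z. int_encode (f (snd z)) \<le> 2 * fst z)"
      by (intro computable_nat computable_compose [OF code])
    show "\<exists>n. int_encode (f x) \<le> 2 * n" for x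
      by (rule exI [of _ "int_encode (f x)"]) simp
  qed
  have 1: "computable (\<lambda>x. if 2 * ?half x = int_encode (f x) then ?half x else 0)"
    by (intro computable_nat half code)
  have 2: "computable (\<lambda>x. if 2 * ?half x = int_encode (f x) then 0 else ?half x)"
    by (intro computable_nat half code)
  have half_eq: "?half x = (if 0 \<le> f x then nat (f x) else nat (- f x))" for x
    by (rule Least_equality) (auto simp: int_encode_def sum_encode_def)
  have even_iff: "2 * ?half x = int_encode (f x) \<longleftrightarrow> 0 \<le> f x" for x
    unfolding half_eq by (auto simp: int_encode_def sum_encode_def)
  have "(if 2 * ?half x = int_encode (f x) then ?half x else 0) = nat (f x)" for x
    unfolding even_iff unfolding half_eq by auto
  with 1 show "computable (\<lambda>x. nat (f x))" by simp
  have "(if 2 * ?half x = int_encode (f x) then 0 else ?half x) = nat (- f x)" for x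
    unfolding even_iff unfolding half_eq by auto
  with 2 show "computable (\<lambda>x. nat (- f x))" by simp
qed

text \<open>Sums and products of integers are rewritten below as such differences, by splitting into
  positive and negative parts.\<close>

lemma computable_int_diff:
  assumes "computable f" "computable g"
  shows "computable (\<lambda>x. int (f x) - int (g x))"
proof -
  have "computable (\<lambda>x. if g x \<le> f x then 2 * (f x - g x) else Suc (2 * (g x - f x - 1)))"
    by (intro computable_nat assms)
  then show ?thesis
    by (rule computable_same_code)
      (auto simp: encode_nat_def encode_int_def int_encode_def sum_encode_def nat_diff_distrib)
qed

lemma computable_int:
  assumes "computable f"
  shows "computable (\<lambda>x. int (f x))"
  using computable_int_diff [OF assms computable_const [of 0]] by simp

lemma computable_add_int:
  assumes "computable f" "computable g"
  shows "computable (\<lambda>x. f x + g x :: int)"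
proof -
  have "computable (\<lambda>x. int (nat (f x) + nat (g x)) - int (nat (- f x) + nat (- g x)))"
    by (intro computable_int_diff computable_nat computable_nat_of_int assms)
  moreover have "int (nat i + nat j) - int (nat (- i) + nat (- j)) = i + j" for i j
    by simp
  ultimately show ?thesis by (simp only:)
qed

lemma computable_mult_int:
  assumes "computable f" "computable g"
  shows "computable (\<lambda>x. f x * g x :: int)"
proof -
  have "computable (\<lambda>x. int (nat (f x) * nat (g x) + nat (- f x) * nat (- g x))
      - int (nat (f x) * nat (- g x) + nat (- f x) * nat (g x)))"
    by (intro computable_int_diff computable_nat computable_nat_of_int assms)
  moreover have "int (nat i * nat j + nat (- i) * nat (- j))
      - int (nat i * nat (- j) + nat (- i) * nat j) = i * j" for i j
    by (simp add: max_def)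
  ultimately show ?thesis by (simp only:)
qed

lemma computable_le_int:
  assumes "computable f" "computable g"
  shows "computable (\<lambda>x. f x \<le> (g x :: int))"
proof -
  have "computable (\<lambda>x. nat (f x + (int 0 - int 1) * g x) = 0)"
    by (intro computable_add_int computable_mult_int computable_const computable_nat
        computable_nat_of_int assms)
  then show ?thesis by simp
qed

text \<open>Cancelling a common factor leads to an earlier diagonal of the pairing, so the pair of
  least code is in lowest terms. Search can thus replace a computation of the gcd.\<close>

lemma quotient_of_nonneg_fraction:
  fixes a b :: nat
  assumes "b > 0" "0 < q" "a * q = b * p" "\<And>p' q'. 0 < q' \<Longrightarrow> a * q' = b * p' \<Longrightarrow> prod_encode (p, q) \<le> prod_encode (p', q')"
  shows "quotient_of (of_nat a / of_nat b) = (int p, int q)"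
proof -
  have "coprime p q"
  proof (rule ccontr)
    assume "\<not> coprime p q"
    then obtain p' q' d where d: "p = d * p'" "q = d * q'" "d > 1"
      by (metis assms(2) coprime_iff_gcd_eq_1 dvdE gcd_dvd1 gcd_dvd2 gcd_pos_nat less_one linorder_neqE_nat less_irrefl)
    have "prod_encode (p', q') < prod_encode (p, q)"
    proof -
      have "q' < q" "p' \<le> p" using d assms(2) by auto
      then have "p' + q' < p + q" by simp
      moreover have "triangle i \<le> triangle j" if "i \<le> j" for i j
        using that by (induction rule: dec_induct) auto
      ultimately have "triangle (Suc (p' + q')) \<le> triangle (p + q)"
        by (meson Suc_leI)
      then show ?thesis using \<open>q' < q\<close> by (simp add: prod_encode_def)
    qed
    moreover have "prod_encode (p, q) \<le> prod_encode (p', q')"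
      using assms(2,3) d by (intro assms(4)) auto
    ultimately show False by simp
  qed
  moreover have "(of_nat a / of_nat b :: rat) = Fract (int p) (int q)"
  proof -
    have "(of_nat a * of_nat q :: rat) = of_nat b * of_nat p"
      using assms(3) by (metis of_nat_mult)
    then show ?thesis using assms(1,2) by (simp add: Fract_of_int_quotient field_simps)
  qed
  ultimately show ?thesis
    using assms(2) by (simp add: quotient_of_Fract normalize_stable)
qed

text \<open>The lowest terms of the absolute value are found by search; the sign is put back into
  the numerator.\<close>

lemma computable_fraction:
  assumes "computable i" "computable b"
  shows "computable (\<lambda>x. of_int (i x) / of_nat (b x) :: rat)"
proof -
  define a where "a x = nat (i x) + nat (- i x)" for x
  define P where "P c x \<longleftrightarrow> 0 < snd (prod_decode c) \<and>
    a x * snd (prod_decode c) = b x * fst (prod_decode c)" for c x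
  \<comment> \<open>Division by zero yields \<open>0\<close>, with lowest terms
    \<open>(0, 1)\<close>. The disjunct \<open>b x = 0\<close> makes the search total in that case
    as well.\<close>
  define c where "c x = (if b x = 0 then prod_encode (0, 1) else LEAST c. b x = 0 \<or> P c x)" for x
  have a: "computable a" unfolding a_def by (intro computable_nat computable_nat_of_int assms)
  have ex: "\<exists>c. b x = 0 \<or> P c x" for x
    by (rule exI [of _ "prod_encode (a x, b x)"]) (auto simp: P_def)
  have "computable (\<lambda>x. LEAST c. b x = 0 \<or> P c x)"
  proof (rule computable_Least)
    have "computable (\<lambda>z. if b (snd z) = 0 then True else \<not> snd (prod_decode (fst z)) \<le> 0 \<and>
      a (snd z) * snd (prod_decode (fst z)) = b (snd z) * fst (prod_decode (fst z)))"
      by (intro computable_list computable_compose [OF a] computable_compose [OF assms(2)])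
    then show "computable (\<lambda>z. b (snd z) = 0 \<or> P (fst z) (snd z))"
      by (rule computable_same_code) (simp add: P_def)
  qed (rule ex)
  then have c: "computable c" unfolding c_def by (intro computable_nat assms)
  let ?num = "\<lambda>x. if 0 \<le> i x then int (fst (prod_decode (c x))) else int 0 - int (fst (prod_decode (c x)))"
  have "computable (\<lambda>x. (?num x, snd (prod_decode (c x))))"
    by (intro computable_list computable_le_int computable_int computable_int_diff assms c)
  then show ?thesis
  proof (rule computable_same_code)
    fix x
    have abs: "quotient_of (of_nat (a x) / of_nat (b x))
        = (int (fst (prod_decode (c x))), int (snd (prod_decode (c x))))"
    proof (cases "b x = 0")
      case True
      then show ?thesis by (simp add: c_def quotient_of_def [symmetric])
    next
      case False
      then have c_eq: "c x = (LEAST c. P c x)" by (simp add: c_def)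
      moreover have "P (LEAST c. P c x) x"
        using ex [of x] False by (auto intro: LeastI)
      ultimately have P: "P (c x) x" by simp
      have "c x \<le> prod_encode (p', q')" if "0 < q'" "a x * q' = b x * p'" for p' q'
        using that c_eq by (auto intro!: Least_le simp: P_def)
      then show ?thesis
        using False P by (intro quotient_of_nonneg_fraction) (auto simp: P_def)
    qed
    have "quotient_of (of_int (i x) / of_nat (b x)) = (?num x, int (snd (prod_decode (c x))))"
    proof (cases "0 \<le> i x")
      case True
      then have "(of_int (i x) :: rat) = of_nat (a x)" by (simp add: a_def)
      with True abs show ?thesis by simp
    next
      case False
      then have "(of_int (i x) :: rat) = - of_nat (a x)" by (simp add: a_def)
      with False abs show ?thesis by (simp add: rat_uminus_code)
    qed
    then show "encode (?num x, snd (prod_decode (c x))) = encode (of_int (i x) / of_nat (b x) :: rat)"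
      by (simp add: encode_prod_def encode_int_def encode_nat_def encode_rat_def rat_encode_def)
  qed
qed

lemma computable_quotient_of:
  assumes "computable f"
  shows "computable (\<lambda>x. fst (quotient_of (f x)))" "computable (\<lambda>x. nat (snd (quotient_of (f x))))"
proof -
  have code: "computable (\<lambda>x. encode (f x))"
    by (rule computable_same_code [OF assms]) (simp add: encode_nat_def)
  have 1: "computable (\<lambda>x. fst (prod_decode (encode (f x))))"
    "computable (\<lambda>x. snd (prod_decode (encode (f x))))"
    by (intro computable_list code)+
  show "computable (\<lambda>x. fst (quotient_of (f x)))"
    by (rule computable_same_code [OF 1(1)])
      (simp add: encode_nat_def encode_rat_def encode_int_def rat_encode_def)
  show "computable (\<lambda>x. nat (snd (quotient_of (f x))))"
    by (rule computable_same_code [OF 1(2)])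
      (simp add: encode_nat_def encode_rat_def rat_encode_def)
qed

lemma rat_eq_fraction:
  "(p :: rat) = of_int (fst (quotient_of p)) / of_nat (nat (snd (quotient_of p)))"
  "0 < nat (snd (quotient_of p))"
  using quotient_of_div [of p "fst (quotient_of p)" "snd (quotient_of p)"]
    quotient_of_denom_pos' [of p] by simp_all

lemma computable_add_rat:
  assumes "computable f" "computable g"
  shows "computable (\<lambda>x. f x + g x :: rat)"
proof -
  let ?n = "\<lambda>p :: rat. fst (quotient_of p)" and ?d = "\<lambda>p :: rat. nat (snd (quotient_of p))"
  have "computable (\<lambda>x. of_int (?n (f x) * int (?d (g x)) + ?n (g x) * int (?d (f x)))
      / of_nat (?d (f x) * ?d (g x)) :: rat)"
    by (intro computable_fraction computable_add_int computable_mult_int computable_int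
        computable_nat computable_quotient_of assms)
  moreover have "of_int (?n p * int (?d q) + ?n q * int (?d p)) / of_nat (?d p * ?d q) = p + q" for p q
    using rat_eq_fraction [of p] rat_eq_fraction [of q] by (simp add: add_divide_distrib)
  ultimately show ?thesis by (simp only:)
qed

lemma computable_mult_rat:
  assumes "computable f" "computable g"
  shows "computable (\<lambda>x. f x * g x :: rat)"
proof -
  let ?n = "\<lambda>p :: rat. fst (quotient_of p)" and ?d = "\<lambda>p :: rat. nat (snd (quotient_of p))"
  have "computable (\<lambda>x. of_int (?n (f x) * ?n (g x)) / of_nat (?d (f x) * ?d (g x)) :: rat)"
    by (intro computable_fraction computable_mult_int computable_nat computable_quotient_of assms)
  moreover have "of_int (?n p * ?n q) / of_nat (?d p * ?d q) = p * q" for p q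
    using rat_eq_fraction(1) [of p] rat_eq_fraction(1) [of q]
    by (metis of_int_mult of_nat_mult times_divide_times_eq)
  ultimately show ?thesis by (simp only:)
qed

lemma computable_diff_rat:
  assumes "computable f" "computable g"
  shows "computable (\<lambda>x. f x - g x :: rat)"
proof -
  have "computable (\<lambda>x. f x + (- 1) * g x)"
    by (intro computable_add_rat computable_mult_rat computable_const assms)
  then show ?thesis by simp
qed

lemma computable_le_rat:
  assumes "computable f" "computable g"
  shows "computable (\<lambda>x. f x \<le> (g x :: rat))"
proof -
  let ?n = "\<lambda>p :: rat. fst (quotient_of p)" and ?d = "\<lambda>p :: rat. nat (snd (quotient_of p))"
  have "computable (\<lambda>x. ?n (f x) * int (?d (g x)) \<le> ?n (g x) * int (?d (f x)))"
    by (intro computable_le_int computable_mult_int computable_int computable_quotient_of assms)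
  moreover have "?n p * int (?d q) \<le> ?n q * int (?d p) \<longleftrightarrow> p \<le> q" for p q
    using rat_less_eq_code [of p q] by (simp add: quotient_of_denom_pos' less_imp_le case_prod_beta mult.commute)
  ultimately show ?thesis by (simp only:)
qed

lemma computable_max_rat:
  assumes "computable f" "computable g"
  shows "computable (\<lambda>x. max (f x) (g x :: rat))"
  unfolding max_def by (intro computable_If computable_le_rat assms)

lemma computable_power_rat:
  assumes "computable f" "computable n"
  shows "computable (\<lambda>x. f x ^ n x :: rat)"
proof -
  have "computable (\<lambda>x. rec_nat 1 (\<lambda>_ y. f x * y) (n x))"
    by (intro computable_rec_nat computable_mult_rat computable_basic
        computable_compose [OF assms(1)] assms)
  moreover have "rec_nat 1 (\<lambda>_ y. p * y) n = p ^ n" for p :: rat and n by (induction n) auto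
  ultimately show ?thesis by simp
qed

lemma computable_sum_rat:
  fixes f :: "nat \<Rightarrow> 'a :: encodable \<Rightarrow> rat"
  assumes "computable (\<lambda>z. f (fst z) (snd z))" "computable n"
  shows "computable (\<lambda>x. \<Sum>i<n x. f i x :: rat)"
proof -
  have "computable (\<lambda>x. rec_nat 0 (\<lambda>i y. y + f i x) (n x))"
    by (intro computable_rec_nat computable_add_rat computable_basic
        computable_compose2 [OF assms(1)] assms)
  moreover have "rec_nat 0 (\<lambda>i y. y + h i) n = (\<Sum>i<n. h i)" for h :: "nat \<Rightarrow> rat" and n
    by (induction n) auto
  ultimately show ?thesis by simp
qed

lemmas computable_rat = computable_list computable_add_rat computable_mult_rat computable_diff_rat
  computable_le_rat computable_max_rat computable_power_rat

lemma computable_int_decode: "computable f \<Longrightarrow> computable (\<lambda>x. int_decode (f x))"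
  by (erule computable_same_code) (simp add: encode_nat_def encode_int_def)

lemma computable_endpoints: "computable f \<Longrightarrow> computable (\<lambda>x. endpoints (f x))"
  by (erule computable_same_code) (simp add: encode_rat_forecast_def)

text \<open>Defined on every number, so that any output of any program can be read as a
  rational.\<close>

definition rat_decode :: "nat \<Rightarrow> rat" where
  "rat_decode c = of_int (int_decode (fst (prod_decode c))) / of_nat (snd (prod_decode c))"

lemma rat_decode_encode: "rat_decode (rat_encode q) = q"
  using rat_eq_fraction [of q] by (simp add: rat_decode_def rat_encode_def)

lemma computable_rat_decode: "computable f \<Longrightarrow> computable (\<lambda>x. rat_decode (f x))"
  unfolding rat_decode_def
  by (intro computable_fraction computable_int_decode computable_list)


section \<open>A universal machine\<close>

text \<open>All constructors share the format (tag, number, list of numbers), so one decoder serves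
  for all of them.\<close>

primrec code :: "recf \<Rightarrow> nat" where
  "code Zero = encode (0 :: nat, 0 :: nat, [] :: nat list)"
| "code Succ = encode (1 :: nat, 0 :: nat, [] :: nat list)"
| "code (Proj i) = encode (2 :: nat, i, [] :: nat list)"
| "code (Comp f gs) = encode (3 :: nat, code f, map code gs)"
| "code (PrimRec f g) = encode (4 :: nat, code f, [code g])"
| "code (Mu f) = encode (5 :: nat, code f, [] :: nat list)"

definition decode_prog :: "nat \<Rightarrow> nat \<times> nat \<times> nat list" where
  "decode_prog c = (let (t, d) = prod_decode c; (n, l) = prod_decode d in (t, n, list_decode l))"

lemma decode_prog_encode [simp]: "decode_prog (encode (t, n :: nat, l :: nat list)) = (t, n, l)"
  by (simp add: decode_prog_def encode_prod_def encode_list_def encode_nat_def [abs_def] map_idI)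

lemma computable_decode_prog: "computable f \<Longrightarrow> computable (\<lambda>x. decode_prog (f x))"
  by (erule computable_same_code)
    (simp add: decode_prog_def encode_prod_def encode_list_def encode_nat_def [abs_def] split_beta map_idI)

text \<open>A state \<open>(ret, c, xs, K)\<close> of the abstract machine evaluates the program with code \<open>c\<close> on
  \<open>xs\<close> (if \<open>\<not> ret\<close>) or returns the value \<open>c\<close> (if \<open>ret\<close>) to the stack \<open>K\<close> of pending frames
  \<open>(kind, program, counter, programs, values, arguments)\<close>. The kinds \<open>0\<close>, \<open>1\<close> and \<open>2\<close> belong
  to composition, primitive recursion and minimisation.\<close>

type_synonym frame = "nat \<times> nat \<times> nat \<times> nat list \<times> nat list \<times> nat list"
type_synonym machine_state = "bool \<times> nat \<times> nat list \<times> frame list"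

definition next_arg :: "nat \<Rightarrow> nat list \<Rightarrow> nat list \<Rightarrow> nat list \<Rightarrow> frame list \<Rightarrow> machine_state" where
  "next_arg f gs ys xs K =
     (if gs = [] then (False, f, ys, K) else (False, hd gs, xs, (0, f, 0, tl gs, ys, xs) # K))"

definition return_step :: "nat \<Rightarrow> frame \<Rightarrow> frame list \<Rightarrow> machine_state" where
  "return_step y = (\<lambda>(t, f, n, gs, ys, xs) K.
     if t = 0 then next_arg f gs (ys @ [y]) xs K
     else if t = 1 then (False, f, n # y # xs, K)
     else if y = 0 then (True, n, [], K)
     else (False, f, Suc n # xs, (2, f, Suc n, [], [], xs) # K))"

text \<open>Ill-formed codes or arguments have arbitrary successors; the machine is only claimed to
  follow evaluations derivable by \<open>rec_eval\<close>.\<close>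

definition eval_step :: "nat \<Rightarrow> nat list \<Rightarrow> frame list \<Rightarrow> machine_state" where
  "eval_step c xs K = (case decode_prog c of (t, f, gs) \<Rightarrow>
     if t = 0 then (True, 0, [], K)
     else if t = 1 then (True, Suc (hd xs), [], K)
     else if t = 2 then (True, hd (drop f xs), [], K)
     else if t = 3 then next_arg f gs [] xs K
     else if t = 4 then
       (if hd xs = 0 then (False, f, tl xs, K)
        else (False, c, (hd xs - 1) # tl xs, (1, hd gs, hd xs - 1, [], [], tl xs) # K))
     else (False, f, 0 # xs, (2, f, 0, [], [], xs) # K))"

text \<open>A value returned to the empty stack is a fixed point, so a halted run stays
  halted.\<close>

definition machine_step :: "machine_state \<Rightarrow> machine_state" where
  "machine_step = (\<lambda>(ret, c, xs, K).
     if ret then (if K = [] then (ret, c, xs, K) else return_step c (hd K) (tl K))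
     else eval_step c xs K)"

lemma computable_machine_step: "computable f \<Longrightarrow> computable (\<lambda>x. machine_step (f x))"
  unfolding machine_step_def return_step_def eval_step_def next_arg_def case_prod_beta
  by (intro computable_list computable_decode_prog)

abbreviation reaches :: "machine_state \<Rightarrow> machine_state \<Rightarrow> bool" where
  "reaches \<equiv> (\<lambda>s t. t = machine_step s)\<^sup>*\<^sup>*"

lemma reaches_step: "reaches (machine_step s) t \<Longrightarrow> reaches s t"
  by (rule converse_rtranclp_into_rtranclp) simp_all

lemma machine_step_simps [simp]:
  "machine_step (True, c, xs, []) = (True, c, xs, [])"
  "machine_step (True, y, xs, k # K) = return_step y k K"
  "machine_step (False, c, xs, K) = eval_step c xs K"
  by (simp_all add: machine_step_def)

text \<open>The hypothesis ranges over all stacks because each argument is evaluated on top of the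
  frame that stores the remaining ones.\<close>

lemma reaches_args:
  assumes "list_all2 (\<lambda>g y. \<forall>K. reaches (False, code g, xs, K) (True, y, [], K)) gs ys"
  shows "reaches (next_arg f (map code gs) zs xs K) (False, f, zs @ ys, K)"
  using assms
proof (induction arbitrary: zs rule: list_all2_induct)
  case (Cons g gs y ys)
  let ?F = "(0, f, 0, map code gs, zs, xs)"
  have "reaches (next_arg f (map code (g # gs)) zs xs K) (True, y, [], ?F # K)"
    using Cons.hyps(1) by (simp add: next_arg_def)
  also have "reaches (True, y, [], ?F # K) (False, f, zs @ y # ys, K)"
    using Cons.IH [of "zs @ [y]"] by - (rule reaches_step, simp add: return_step_def)
  finally show ?case .
qed (simp add: next_arg_def)

text \<open>Downward induction on \<open>m\<close>: a rejected candidate passes control to its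
  successor, until \<open>n\<close> is returned.\<close>

lemma reaches_Mu:
  assumes "reaches (False, f, n # xs, (2, f, n, [], [], xs) # K) (True, 0, [], (2, f, n, [], [], xs) # K)"
    and "\<And>i. i < n \<Longrightarrow> \<exists>y. reaches (False, f, i # xs, (2, f, i, [], [], xs) # K)
      (True, Suc y, [], (2, f, i, [], [], xs) # K)"
    and "m \<le> n"
  shows "reaches (False, f, m # xs, (2, f, m, [], [], xs) # K) (True, n, [], K)"
  using assms(3)
proof (induction rule: inc_induct)
  case base
  have "reaches (True, 0, [], (2, f, n, [], [], xs) # K) (True, n, [], K)"
    by (rule reaches_step) (simp add: return_step_def)
  with assms(1) show ?case by (rule rtranclp_trans)
next
  case (step m)
  then obtain y where "reaches (False, f, m # xs, (2, f, m, [], [], xs) # K)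
      (True, Suc y, [], (2, f, m, [], [], xs) # K)"
    using assms(2) by blast
  also have "reaches \<dots> (True, n, [], K)"
    using step.IH by - (rule reaches_step, simp add: return_step_def)
  finally show ?case .
qed

text \<open>The stack is generalised because subprograms run on top of pending frames. That no other
  output is possible follows later from determinism of the machine.\<close>

lemma rec_eval_reaches:
  "rec_eval r xs y \<Longrightarrow> reaches (False, code r, xs, K) (True, y, [], K)"
proof (induction arbitrary: K rule: rec_eval.induct)
  case (comp xs gs ys f z)
  have "list_all2 (\<lambda>g y. \<forall>K. reaches (False, code g, xs, K) (True, y, [], K)) gs ys"
    using comp.IH(1) by (rule list_all2_mono) blast
  from reaches_args [OF this, of "code f" "[]" K]
  have "reaches (machine_step (False, code (Comp f gs), xs, K)) (False, code f, ys, K)"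
    by (simp add: eval_step_def)
  from reaches_step [OF this] show ?case by (rule rtranclp_trans) (rule comp.IH(2))
next
  case (primrec_0 f xs y g)
  then show ?case by - (rule reaches_step, simp add: eval_step_def)
next
  case (primrec_Suc f g n xs y z)
  let ?F = "(1, code g, n, [], [], xs)"
  have "reaches (False, code (PrimRec f g), Suc n # xs, K) (True, y, [], ?F # K)"
    using primrec_Suc.IH(1) [of "?F # K"] by - (rule reaches_step, simp add: eval_step_def)
  also have "reaches \<dots> (True, z, [], K)"
    using primrec_Suc.IH(2) [of K] by - (rule reaches_step, simp add: return_step_def)
  finally show ?case .
next
  case (mu f n xs)
  have "reaches (False, code f, 0 # xs, (2, code f, 0, [], [], xs) # K) (True, n, [], K)"
    using mu.IH by (intro reaches_Mu) blast+
  then show ?case by - (rule reaches_step, simp add: eval_step_def)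
qed (rule reaches_step, simp add: eval_step_def hd_drop_conv_nth)+

definition machine_run :: "nat \<Rightarrow> nat \<Rightarrow> nat list \<Rightarrow> machine_state" where
  "machine_run t c xs = (machine_step ^^ t) (False, c, xs, [])"

lemma computable_machine_run:
  assumes "computable t" "computable c" "computable xs"
  shows "computable (\<lambda>x. machine_run (t x) (c x) (xs x))"
proof -
  have "computable (\<lambda>x. rec_nat (False, c x, xs x, []) (\<lambda>_ s. machine_step s) (t x))"
    by (intro computable_rec_nat computable_machine_step computable_basic assms)
  moreover have "rec_nat s (\<lambda>_ s. machine_step s) n = (machine_step ^^ n) s" for s n
    by (induction n) auto
  ultimately show ?thesis by (simp add: machine_run_def)
qed

text \<open>The default \<open>0\<close> before halting is harmless in the running maxima that
  approximate a nonnegative map.\<close>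

definition machine_output :: "nat \<Rightarrow> nat \<Rightarrow> nat list \<Rightarrow> rat" where
  "machine_output t c xs = (case machine_run t c xs of (ret, y, zs, K) \<Rightarrow>
     if ret \<and> K = [] then rat_decode y else 0)"

lemma computable_machine_output:
  assumes "computable t" "computable c" "computable xs"
  shows "computable (\<lambda>x. machine_output (t x) (c x) (xs x))"
  unfolding machine_output_def case_prod_beta
  by (intro computable_list computable_rat_decode computable_machine_run assms)

lemma machine_output_rec_eval:
  assumes "rec_eval r xs (rat_encode q)"
  shows "\<exists>t. machine_output t (code r) xs = q" "machine_output t (code r) xs \<in> {0, q}"
proof -
  let ?s = "(False, code r, xs, []) :: machine_state" and ?h = "(True, rat_encode q, [], []) :: machine_state"
  have fix_h: "(machine_step ^^ t) (True, y, zs, []) = (True, y, zs, [])" for t y zs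
    by (induction t) auto
  have "reaches s u \<Longrightarrow> \<exists>t. u = (machine_step ^^ t) s" for s u
  proof (induction rule: rtranclp_induct)
    case base
    show ?case by (rule exI [of _ 0]) simp
  next
    case (step u v)
    then show ?case by (metis funpow.simps(2) comp_apply)
  qed
  with rec_eval_reaches [OF assms] obtain t0 where t0: "(machine_step ^^ t0) ?s = ?h"
    by metis
  then show "\<exists>t. machine_output t (code r) xs = q"
    by (intro exI [of _ t0]) (simp add: machine_output_def machine_run_def rat_decode_encode)
  show "machine_output t (code r) xs \<in> {0, q}"
  proof -
    obtain ret y zs K where s: "(machine_step ^^ t) ?s = (ret, y, zs, K)" by (metis prod_cases4)
    have "rat_decode y = q" if "ret" "K = []"
    proof -
      \<comment> \<open>Both halted states are continued to the same total number of steps, where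
        they have to coincide.\<close>
      have "(machine_step ^^ (t0 + t)) ?s = (ret, y, zs, K)"
        using s that by (simp add: funpow_add fix_h)
      moreover have "(machine_step ^^ (t + t0)) ?s = ?h"
        using t0 by (simp add: funpow_add fix_h)
      ultimately show ?thesis by (auto simp: add.commute rat_decode_encode)
    qed
    then show ?thesis by (auto simp: machine_output_def machine_run_def s)
  qed
qed


section \<open>Trimming approximations to superfarthingales\<close>

definition mean :: "('a :: field) \<Rightarrow> (bool \<Rightarrow> 'a) \<Rightarrow> 'a" where
  "mean p f = p * f True + (1 - p) * f False"

lemma of_rat_mean: "of_rat (mean p f) = mean (of_rat p) (\<lambda>x. of_rat (f x) :: real)"
  by (simp add: mean_def of_rat_add of_rat_mult of_rat_diff)

abbreviation ends :: "rat_forecast \<Rightarrow> rat set" where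
  "ends I \<equiv> {fst (endpoints I), snd (endpoints I)}"

lemma ends_bounds: "p \<in> ends I \<Longrightarrow> 0 \<le> p \<and> p \<le> 1"
  using endpoints_bounds [of I] by auto

lemma mean_mono:
  fixes p :: "'a :: linordered_field"
  assumes "0 \<le> p" "p \<le> 1" "\<And>x. f x \<le> g x"
  shows "mean p f \<le> mean p g"
  using assms by (auto simp: mean_def intro!: add_mono mult_left_mono)

text \<open>The expectation is affine in \<open>p\<close>, so its maximum lies at an endpoint. For
  rational values, this makes the superfarthingale inequality decidable.\<close>

lemma upper_expectation_le_iff:
  "upper_expectation (interval I) f \<le> c \<longleftrightarrow> (\<forall>p\<in>ends I. mean (of_rat p) f \<le> c)"
proof -
  define a b where "a = real_of_rat (fst (endpoints I))" and "b = real_of_rat (snd (endpoints I))"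
  have ab: "0 \<le> a" "a \<le> b" "b \<le> 1"
    using endpoints_bounds [of I] by (simp_all add: a_def b_def of_rat_less_eq)
  have I: "interval I = {a..b}" by (simp add: interval_def a_def b_def)
  from upper_expectation_attained [OF ab, of f] obtain p where p: "p \<in> {a..b}"
    "upper_expectation {a..b} f = mean p f" "\<And>q. q \<in> {a..b} \<Longrightarrow> mean q f \<le> mean p f"
    unfolding mean_def by blast
  have affine: "mean q f = f False + q * (f True - f False)" for q
    by (simp add: mean_def algebra_simps)
  have "mean p f \<le> max (mean a f) (mean b f)"
  proof (cases "f True \<le> f False")
    case True
    then have "mean p f \<le> mean a f"
      using p(1) by (auto simp: affine intro: mult_right_mono_neg)
    then show ?thesis by simp
  next
    case False
    then have "mean p f \<le> mean b f"
      using p(1) by (auto simp: affine intro: mult_right_mono)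
    then show ?thesis by simp
  qed
  moreover have "mean a f \<le> mean p f" "mean b f \<le> mean p f"
    using p(3) ab by auto
  ultimately show ?thesis
    unfolding I p(2) by (auto simp: a_def [symmetric] b_def [symmetric])
qed

lemma superfarthingale_iff:
  "superfarthingale F \<longleftrightarrow> (\<forall>v I. \<forall>p\<in>ends I. mean (of_rat p) (\<lambda>x. F (v @ [(I, x)])) \<le> F v)"
  by (simp only: superfarthingale_def upper_expectation_le_iff)

definition possible :: "rat_forecast \<times> bool \<Rightarrow> bool" where
  "possible z \<longleftrightarrow> interval (fst z) \<noteq> {1 - of_bool (snd z)}"

text \<open>Provides a test on the rational endpoints that a program can carry out.\<close>

lemma possible_iff:
  "possible z \<longleftrightarrow> (if snd z then \<not> snd (endpoints (fst z)) \<le> 0 else \<not> 1 \<le> fst (endpoints (fst z)))"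
proof -
  have "interval I = {1 - of_bool x} \<longleftrightarrow> (if x then snd (endpoints I) \<le> 0 else 1 \<le> fst (endpoints I))" for I x
    using endpoints_bounds [of I] by (auto simp: interval_def atLeastAtMost_singleton_iff)
  then show ?thesis by (simp add: possible_def)
qed

text \<open>The set of \<open>k\<close> with \<open>admissible Q k g v I\<close> grows with \<open>g\<close> and, if \<open>Q\<close> increases in \<open>k\<close>, is
  closed downwards.\<close>

definition admissible :: "(nat \<Rightarrow> situation \<Rightarrow> rat) \<Rightarrow> nat \<Rightarrow> rat \<Rightarrow> situation \<Rightarrow> rat_forecast \<Rightarrow> bool" where
  "admissible Q k g v I \<longleftrightarrow> (\<forall>p\<in>ends I. mean p (\<lambda>x. Q k (v @ [(I, x)])) \<le> g)"

text \<open>The scan keeps the last admissible index below \<open>s\<close>, with value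
  \<open>0\<close> if there is none. Writing it with \<open>rec_nat\<close> lets
  \<open>computable_rec_nat\<close> apply.\<close>

definition latest_admissible ::
  "(nat \<Rightarrow> situation \<Rightarrow> rat) \<Rightarrow> nat \<Rightarrow> rat \<Rightarrow> situation \<Rightarrow> rat_forecast \<times> bool \<Rightarrow> rat" where
  "latest_admissible Q s g v z =
     rec_nat 0 (\<lambda>k y. if admissible Q k g v (fst z) then Q k (v @ [z]) else y) s"

lemma latest_admissible_simps [simp]:
  "latest_admissible Q 0 g v z = 0"
  "latest_admissible Q (Suc k) g v z =
     (if admissible Q k g v (fst z) then Q k (v @ [z]) else latest_admissible Q k g v z)"
  by (simp_all add: latest_admissible_def)

definition trim_step ::
  "(nat \<Rightarrow> situation \<Rightarrow> rat) \<Rightarrow> nat \<Rightarrow> rat \<Rightarrow> situation \<Rightarrow> rat_forecast \<times> bool \<Rightarrow> rat" where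
  "trim_step Q s g v z = (if possible z then latest_admissible Q s g v z else 0)"

text \<open>The fold carries the prefix read so far next to its value, as each step depends on both;
  \<open>computable_foldl\<close> then applies.\<close>

definition trim :: "(nat \<Rightarrow> situation \<Rightarrow> rat) \<Rightarrow> nat \<Rightarrow> situation \<Rightarrow> rat" where
  "trim Q s v = snd (foldl (\<lambda>ug z. (fst ug @ [z], trim_step Q s (snd ug) (fst ug) z)) ([], 1) v)"

lemma trim_Nil [simp]: "trim Q s [] = 1"
  by (simp add: trim_def)

lemma trim_snoc [simp]: "trim Q s (v @ [z]) = trim_step Q s (trim Q s v) v z"
proof -
  have "fst (foldl (\<lambda>ug z. (fst ug @ [z], trim_step Q s (snd ug) (fst ug) z)) ([], 1) v) = v"
    by (induction v rule: rev_induct) auto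
  then show ?thesis by (simp add: trim_def)
qed

definition increasing_nonneg :: "(nat \<Rightarrow> situation \<Rightarrow> rat) \<Rightarrow> bool" where
  "increasing_nonneg Q \<longleftrightarrow> (\<forall>v. mono (\<lambda>k. Q k v)) \<and> (\<forall>k v. 0 \<le> Q k v)"

section \<open>Positivity, monotonicity and the superfarthingale property of trimming\<close>

context
  fixes Q :: "nat \<Rightarrow> situation \<Rightarrow> rat"
  assumes Q: "increasing_nonneg Q"
begin

lemma latest_admissible_nonneg: "0 \<le> latest_admissible Q s g v z"
  using Q by (induction s) (auto simp: increasing_nonneg_def)

lemma latest_admissible_le: "latest_admissible Q s g v z \<le> Q s (v @ [z])"
proof (induction s)
  case 0
  then show ?case using Q by (auto simp: increasing_nonneg_def)
next
  case (Suc s)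
  have "Q s (v @ [z]) \<le> Q (Suc s) (v @ [z])"
    using Q by (auto simp: increasing_nonneg_def mono_def)
  with Suc show ?case by auto
qed

lemma latest_admissible_mono_stage:
  assumes "s \<le> t"
  shows "latest_admissible Q s g v z \<le> latest_admissible Q t g v z"
  using assms
proof (induction rule: dec_induct)
  case (step t)
  then show ?case using latest_admissible_le [of t g v z] by auto
qed simp

lemma latest_admissible_mono_bound:
  assumes "g \<le> h"
  shows "latest_admissible Q s g v z \<le> latest_admissible Q s h v z"
proof (induction s)
  case (Suc s)
  have "admissible Q s h v (fst z)" if "admissible Q s g v (fst z)"
    using that assms by (auto simp: admissible_def)
  with Suc show ?case using latest_admissible_le [of s g v z] by auto
qed simp

text \<open>Admissibility depends on \<open>I\<close> but not on the outcome, so both children take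
  their values from the same index \<open>k\<close>.\<close>

lemma mean_latest_admissible:
  assumes "p \<in> ends I" "0 \<le> g"
  shows "mean p (\<lambda>x. latest_admissible Q s g v (I, x)) \<le> g"
proof (induction s)
  case 0
  then show ?case using assms(2) by (simp add: mean_def)
next
  case (Suc s)
  then show ?case using assms(1) by (cases "admissible Q s g v I") (auto simp: admissible_def)
qed

lemma trim_nonneg: "0 \<le> trim Q s v"
  by (cases v rule: rev_cases) (simp_all add: trim_step_def latest_admissible_nonneg)

text \<open>Replacing nonnegative values by \<open>0\<close> at impossible outcomes can only lower
  the mean.\<close>

lemma mean_trim:
  assumes "p \<in> ends I"
  shows "mean p (\<lambda>x. trim Q s (v @ [(I, x)])) \<le> trim Q s v"
proof -
  have "mean p (\<lambda>x. trim Q s (v @ [(I, x)])) \<le> mean p (\<lambda>x. latest_admissible Q s (trim Q s v) v (I, x))"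
    using ends_bounds [OF assms]
    by (intro mean_mono) (simp_all add: trim_step_def latest_admissible_nonneg)
  also have "\<dots> \<le> trim Q s v"
    by (rule mean_latest_admissible [OF assms trim_nonneg])
  finally show ?thesis .
qed

text \<open>The stage enters as the number of candidates and through the bound at the parent; both
  effects are increasing.\<close>

lemma trim_mono:
  assumes "s \<le> t"
  shows "trim Q s v \<le> trim Q t v"
proof (induction v rule: rev_induct)
  case (snoc z v)
  then show ?case
    using latest_admissible_mono_stage [OF assms, of "trim Q s v" v z]
      latest_admissible_mono_bound [of "trim Q s v" "trim Q t v" t v z]
    by (simp add: trim_step_def)
qed simp

end

text \<open>The bound does not depend on \<open>Q\<close>, which makes the infinite mixture finite.
  A possible outcome has positive probability \<open>w\<close> at some endpoint, so its value is at
  most \<open>1 / w\<close> times the bound at the parent; an impossible one has value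
  \<open>0\<close>.\<close>

lemma trim_bounded: "\<exists>C. \<forall>Q s. increasing_nonneg Q \<longrightarrow> trim Q s v \<le> C"
proof (induction v rule: rev_induct)
  case Nil
  show ?case by (rule exI [of _ 1]) simp
next
  case (snoc z v)
  then obtain C where C: "trim Q s v \<le> C" if "increasing_nonneg Q" for Q s by blast
  obtain I x where z: "z = (I, x)" by (cases z)
  define w where "w = (if x then snd (endpoints I) else 1 - fst (endpoints I))"
  show ?case
  proof (cases "possible z")
    case True
    then have w: "w > 0" by (auto simp: possible_iff w_def z split: if_splits)
    have "trim Q s (v @ [z]) \<le> C / w" if "increasing_nonneg Q" for Q s
    proof -
      define p where "p = (if x then snd (endpoints I) else fst (endpoints I))"
      have p: "p \<in> ends I" by (simp add: p_def)
      have "w * trim Q s (v @ [z]) \<le> mean p (\<lambda>x. trim Q s (v @ [(I, x)]))"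
        using ends_bounds [OF p] trim_nonneg [OF that] by (auto simp: mean_def w_def p_def z simp del: trim_snoc)
      also have "\<dots> \<le> trim Q s v" by (rule mean_trim [OF that p])
      also have "\<dots> \<le> C" by (rule C [OF that])
      finally show ?thesis using w by (simp add: field_simps)
    qed
    then show ?thesis by blast
  next
    case False
    then show ?thesis by (intro exI [of _ 0]) (simp add: trim_step_def)
  qed
qed

text \<open>The factor \<open>1 - (1/2)\<^sup>k\<close> makes the inequality between upper expectation and value strict, so that each
  approximation becomes admissible as soon as the trimmed value at the parent is close enough to its limit.\<close>

definition damped :: "(nat \<Rightarrow> situation \<Rightarrow> rat) \<Rightarrow> nat \<Rightarrow> situation \<Rightarrow> rat" where
  "damped A k v = (1 - (1/2) ^ k) * A k v"

lemma damping_bounds: "0 \<le> 1 - (1/2 :: rat) ^ k" "1 - (1/2 :: rat) ^ k < 1"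
  by (simp_all add: power_le_one)

lemma increasing_nonneg_damped:
  assumes "increasing_nonneg A"
  shows "increasing_nonneg (damped A)"
  using assms damping_bounds(1) unfolding increasing_nonneg_def damped_def mono_def
  by (auto intro!: mult_mono diff_left_mono power_decreasing)

text \<open>By induction along \<open>v\<close>: once the parent's value is near its limit, any
  fixed index is admissible at the child, so the limit there is at least every \<open>Q k\<close>.
  Conversely, trimmed values never exceed \<open>A s\<close>, hence never \<open>F\<close>.\<close>

lemma trim_tendsto:
  fixes F :: "situation \<Rightarrow> real"
  assumes A: "increasing_nonneg A" and lim: "\<And>v. (\<lambda>k. real_of_rat (A k v)) \<longlonglongrightarrow> F v"
    and F: "superfarthingale F" "F [] = 1"
    and v: "list_all possible v"
  shows "(\<lambda>s. real_of_rat (trim (damped A) s v)) \<longlonglongrightarrow> F v"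
  using v
proof (induction v rule: rev_induct)
  case Nil
  then show ?case by (simp add: F(2))
next
  case (snoc z v)
  define Q where "Q = damped A"
  have Q: "increasing_nonneg Q" unfolding Q_def by (rule increasing_nonneg_damped [OF A])
  obtain I x where z: "z = (I, x)" by (cases z)
  have A_le: "real_of_rat (A k u) \<le> F u" for k u
    by (rule incseq_le [OF _ lim]) (use A in \<open>auto simp: incseq_def increasing_nonneg_def mono_def of_rat_less_eq\<close>)
  have A_ge: "0 \<le> A k u" for k u using A by (simp add: increasing_nonneg_def)
  have F_ge: "0 \<le> F u" for u
    using A_le [of 0 u] A_ge [of 0 u] by (meson order_trans zero_le_of_rat_iff)
  have IH: "(\<lambda>s. real_of_rat (trim Q s v)) \<longlonglongrightarrow> F v"
    using snoc by (simp add: Q_def)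
  have adm: "\<forall>\<^sub>F s in sequentially. admissible Q k (trim Q s v) v I" for k
  proof -
    have "\<forall>\<^sub>F s in sequentially. mean p (\<lambda>x. Q k (v @ [(I, x)])) \<le> trim Q s v" if p: "p \<in> ends I" for p
    proof -
      define m where "m = mean p (\<lambda>x. A k (v @ [(I, x)]))"
      have "real_of_rat m \<le> mean (of_rat p) (\<lambda>x. F (v @ [(I, x)]))"
        unfolding m_def of_rat_mean using ends_bounds [OF p] A_le by (intro mean_mono) auto
      also have "\<dots> \<le> F v" using F(1) p unfolding superfarthingale_iff by blast
      finally have m: "real_of_rat m \<le> F v" .
      have Q_mean: "mean p (\<lambda>x. Q k (v @ [(I, x)])) = (1 - (1/2) ^ k) * m"
        by (simp add: Q_def damped_def mean_def m_def algebra_simps)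
      show ?thesis
      \<comment> \<open>Damping gives a strict inequality only for positive \<open>m\<close>;
        otherwise nonnegativity of the trimmed value suffices.\<close>
      proof (cases "m \<le> 0")
        case True
        then have "(1 - (1/2) ^ k) * m \<le> 0"
          using damping_bounds(1) [of k] by (rule mult_nonneg_nonpos [rotated])
        then show ?thesis
          unfolding Q_mean using trim_nonneg [OF Q] by (intro always_eventually allI) (rule order_trans)
      next
        case False
        then have "(1 - (1/2) ^ k) * m < m"
          using damping_bounds(2) [of k] by (simp add: mult_less_cancel_right)
        then have "real_of_rat ((1 - (1/2) ^ k) * m) < F v"
          using m by (meson less_le_trans of_rat_less)
        from order_tendstoD(1) [OF IH this] show ?thesis
          unfolding Q_mean by (rule eventually_mono) (simp add: of_rat_less less_imp_le)
      qed
    qed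
    then show ?thesis unfolding admissible_def by (intro eventually_ball_finite) auto
  qed
  have T: "trim Q s (v @ [z]) = latest_admissible Q s (trim Q s v) v z" for s
    using snoc.prems by (simp add: trim_step_def)
  have upper: "real_of_rat (trim Q s (v @ [z])) \<le> F (v @ [z])" for s
  proof -
    have "Q s (v @ [z]) \<le> 1 * A s (v @ [z])"
      unfolding Q_def damped_def using damping_bounds(2) [of s] A_ge by (intro mult_right_mono) auto
    then have "trim Q s (v @ [z]) \<le> A s (v @ [z])"
      unfolding T using latest_admissible_le [OF Q, of s "trim Q s v" v z] by simp
    then show ?thesis using A_le by (meson of_rat_less_eq order_trans)
  qed
  have lower: "\<forall>\<^sub>F s in sequentially. Q k (v @ [z]) \<le> trim Q s (v @ [z])" for k
    using adm [of k] eventually_gt_at_top [of k]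
  proof eventually_elim
    case (elim s)
    \<comment> \<open>At stage \<open>Suc k\<close> the index \<open>k\<close> is the last
      candidate, so being admissible it is the one selected.\<close>
    then have "Q k (v @ [z]) = latest_admissible Q (Suc k) (trim Q s v) v z" by (simp add: z)
    also have "\<dots> \<le> trim Q s (v @ [z])"
      unfolding T using elim by (intro latest_admissible_mono_stage [OF Q]) auto
    finally show ?case .
  qed
  have Q_lim: "(\<lambda>k. real_of_rat (Q k (v @ [z]))) \<longlonglongrightarrow> F (v @ [z])"
  proof -
    have "(\<lambda>k. (1 - (1/2) ^ k) * real_of_rat (A k (v @ [z]))) \<longlonglongrightarrow> (1 - 0) * F (v @ [z])"
      by (intro tendsto_intros lim LIMSEQ_power_zero) simp
    then show ?thesis
      by (simp add: Q_def damped_def of_rat_mult of_rat_diff of_rat_power of_rat_divide)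
  qed
  have "(\<lambda>s. real_of_rat (trim Q s (v @ [z]))) \<longlonglongrightarrow> F (v @ [z])"
  proof (rule order_tendstoI)
    fix c assume "c < F (v @ [z])"
    from order_tendstoD(1) [OF Q_lim this] obtain k where k: "c < real_of_rat (Q k (v @ [z]))"
      by (auto simp: eventually_sequentially)
    from lower [of k] show "\<forall>\<^sub>F s in sequentially. c < real_of_rat (trim Q s (v @ [z]))"
      by (rule eventually_mono) (use k in \<open>meson less_le_trans of_rat_less_eq\<close>)
  next
    fix c assume "F (v @ [z]) < c"
    then show "\<forall>\<^sub>F s in sequentially. real_of_rat (trim Q s (v @ [z])) < c"
      by (intro always_eventually allI le_less_trans [OF upper])
  qed
  then show ?case by (simp add: Q_def)
qed


section \<open>The universal superfarthingale\<close>

text \<open>The number \<open>i\<close> codes a pair (index of an approximation, number of machine steps).\<close>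

definition approx :: "nat \<Rightarrow> nat \<Rightarrow> situation \<Rightarrow> rat" where
  "approx e k v = rec_nat 0 (\<lambda>i y. max y
     (machine_output (snd (prod_decode i)) e [situation_encode v, fst (prod_decode i)])) k"

lemma approx_simps [simp]:
  "approx e 0 v = 0"
  "approx e (Suc i) v = max (approx e i v)
     (machine_output (snd (prod_decode i)) e [situation_encode v, fst (prod_decode i)])"
  by (simp_all add: approx_def)

text \<open>A running maximum started at \<open>0\<close> has this property for every number
  \<open>e\<close>, whatever the machine does with it.\<close>

lemma increasing_nonneg_approx: "increasing_nonneg (approx e)"
proof -
  have "0 \<le> approx e k v" for k v by (induction k) auto
  then show ?thesis
    unfolding increasing_nonneg_def by (auto intro!: mono_iff_le_Suc [THEN iffD2])
qed

text \<open>For the code \<open>e\<close> of a witnessing program, no output exceeds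
  \<open>F v\<close>, and every approximation \<open>q v j\<close> is eventually output.\<close>

lemma approx_tendsto:
  assumes "lower_semicomputable situation_encode F" "\<And>v. 0 \<le> F v"
  shows "\<exists>e. \<forall>v. (\<lambda>k. real_of_rat (approx e k v)) \<longlonglongrightarrow> F v"
proof -
  obtain q r where r: "\<And>v n. rec_eval r [situation_encode v, n] (rat_encode (q v n))"
    and mono: "\<And>v n. q v n \<le> q v (Suc n)"
    and lim: "\<And>v. (\<lambda>m. real_of_rat (q v m)) \<longlonglongrightarrow> F v"
    using assms(1) unfolding lower_semicomputable_def recursive_map_def by blast
  have q_le: "real_of_rat (q v n) \<le> F v" for v n
    by (rule incseq_le [OF incseq_SucI lim]) (simp add: mono of_rat_less_eq)
  have out_le: "real_of_rat (machine_output t (code r) [situation_encode v, j]) \<le> F v" for t v j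
    using machine_output_rec_eval(2) [OF r, of t v j] q_le [of v j] assms(2) [of v] by auto
  have approx_le: "real_of_rat (approx (code r) k v) \<le> F v" for k v
    using out_le by (induction k) (auto simp: assms(2) max_def)
  have approx_mono: "approx (code r) k v \<le> approx (code r) l v" if "k \<le> l" for k l v
    using increasing_nonneg_approx [of "code r"] that by (simp add: increasing_nonneg_def mono_def)
  have "(\<lambda>k. real_of_rat (approx (code r) k v)) \<longlonglongrightarrow> F v" for v
  proof (rule order_tendstoI)
    fix c assume "c < F v"
    from order_tendstoD(1) [OF lim this] obtain j where j: "c < real_of_rat (q v j)"
      by (auto simp: eventually_sequentially)
    obtain t where "machine_output t (code r) [situation_encode v, j] = q v j"
      using machine_output_rec_eval(1) [OF r] by blast
    \<comment> \<open>The value found after \<open>t\<close> steps enters the maximum at index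
      \<open>prod_encode (j, t)\<close>, hence from the next stage on.\<close>
    then have "q v j \<le> approx (code r) (Suc (prod_encode (j, t))) v" by simp
    then have "q v j \<le> approx (code r) k v" if "k \<ge> Suc (prod_encode (j, t))" for k
      using approx_mono [OF that] by (rule order_trans)
    with j show "\<forall>\<^sub>F k in sequentially. c < real_of_rat (approx (code r) k v)"
      unfolding eventually_sequentially by (meson less_le_trans of_rat_less_eq)
  next
    fix c assume "F v < c"
    then show "\<forall>\<^sub>F k in sequentially. real_of_rat (approx (code r) k v) < c"
      by (intro always_eventually allI le_less_trans [OF approx_le])
  qed
  then show ?thesis by blast
qed

text \<open>The same \<open>s\<close> limits the number of components and their stage, so each value
  is a finite rational sum.\<close>

definition mixture :: "nat \<Rightarrow> situation \<Rightarrow> rat" where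
  "mixture s v = (\<Sum>e<s. (1/2) ^ Suc e * trim (damped (approx e)) s v)"

section \<open>Computability of the mixture\<close>

lemma computable_situation_encode: "computable f \<Longrightarrow> computable (\<lambda>x. situation_encode (f x))"
  by (erule computable_same_code) (simp add: encode_nat_def encode_situation)

lemma computable_damped_approx:
  assumes "computable e" "computable k" "computable v"
  shows "computable (\<lambda>x. damped (approx (e x)) (k x) (v x))"
  unfolding damped_def approx_def
  by (intro computable_rat computable_rec_nat computable_machine_output computable_situation_encode
      computable_compose [OF assms(1)] computable_compose [OF assms(3)] assms)

lemma computable_possible: "computable z \<Longrightarrow> computable (\<lambda>x. possible (z x))"
  unfolding possible_iff by (intro computable_rat computable_endpoints)

lemma computable_admissible:
  assumes "computable e" "computable k" "computable g" "computable v" "computable I"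
  shows "computable (\<lambda>x. admissible (damped (approx (e x))) (k x) (g x) (v x) (I x))"
  \<comment> \<open>The quantifier over the two endpoints becomes a conjunction of two rational
    comparisons.\<close>
  unfolding admissible_def mean_def ball_simps
  by (simp only: simp_thms)
    (intro computable_rat computable_endpoints computable_damped_approx assms)

lemma computable_trim_step:
  assumes "computable e" "computable s" "computable g" "computable v" "computable z"
  shows "computable (\<lambda>x. trim_step (damped (approx (e x))) (s x) (g x) (v x) (z x))"
  unfolding trim_step_def latest_admissible_def
  by (intro computable_rec_nat computable_rat computable_possible computable_admissible
      computable_damped_approx computable_compose [OF assms(1)] computable_compose [OF assms(3)]
      computable_compose [OF assms(4)] computable_compose [OF assms(5)] assms)

lemma computable_trim:
  assumes "computable e" "computable s" "computable v"
  shows "computable (\<lambda>x. trim (damped (approx (e x))) (s x) (v x))"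
  unfolding trim_def
  by (intro computable_foldl computable_snd computable_rat computable_trim_step
      computable_compose [OF assms(1)] computable_compose [OF assms(2)] assms)

lemma recursive_mixture: "recursive_map situation_encode (\<lambda>v n. mixture n v)"
proof -
  have "computable (\<lambda>z :: situation \<times> nat. mixture (snd z) (fst z))"
    unfolding mixture_def
    by (intro computable_sum_rat computable_trim computable_rat)
  then obtain r where "\<And>v n. rec_eval r [encode (v :: situation, n :: nat)] (encode (mixture n v))"
    unfolding computable_def by fastforce
  \<comment> \<open>\<open>recursive_map\<close> passes two separate arguments, whereas
    \<open>r\<close> expects the code of their pair.\<close>
  then have "rec_eval (Comp r [pair_prog]) [situation_encode v, n] (rat_encode (mixture n v))" for v n
    using pair_prog [of "situation_encode v" n]
    by (intro rec_eval_Comp1) (auto simp: encode_prod_def encode_situation encode_nat_def encode_rat_def)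
  then show ?thesis unfolding recursive_map_def by blast
qed

section \<open>Properties of the mixture and of its limit\<close>

lemmas increasing_nonneg_components = increasing_nonneg_damped [OF increasing_nonneg_approx]

lemma sum_halves: "(\<Sum>e<s. (1/2) ^ Suc e) = 1 - (1/2 :: rat) ^ s"
  by (induction s) (auto simp: field_simps)

lemma mixture_nonneg: "0 \<le> mixture s v"
  unfolding mixture_def
  by (intro sum_nonneg mult_nonneg_nonneg trim_nonneg increasing_nonneg_components) simp_all

lemma mixture_ge:
  assumes "e < s"
  shows "(1/2) ^ Suc e * trim (damped (approx e)) s v \<le> mixture s v"
  unfolding mixture_def
  using assms trim_nonneg [OF increasing_nonneg_components]
  by (intro member_le_sum) auto

lemma mixture_mono: "mixture s v \<le> mixture (Suc s) v"
proof -
  have "mixture s v \<le> (\<Sum>e<s. (1/2) ^ Suc e * trim (damped (approx e)) (Suc s) v)"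
    unfolding mixture_def
    by (intro sum_mono mult_left_mono trim_mono increasing_nonneg_components) simp_all
  also have "\<dots> \<le> mixture (Suc s) v"
    using trim_nonneg [OF increasing_nonneg_components, of s "Suc s" v] by (simp add: mixture_def)
  finally show ?thesis .
qed

lemma mean_mixture:
  assumes "p \<in> ends I"
  shows "mean p (\<lambda>x. mixture s (v @ [(I, x)])) \<le> mixture s v"
proof -
  have "mean p (\<lambda>x. mixture s (v @ [(I, x)]))
      = (\<Sum>e<s. (1/2) ^ Suc e * mean p (\<lambda>x. trim (damped (approx e)) s (v @ [(I, x)])))"
    unfolding mixture_def mean_def
    by (simp only: sum_distrib_left sum.distrib [symmetric], intro sum.cong refl)
      (simp add: algebra_simps del: trim_snoc power_Suc)
  also have "\<dots> \<le> mixture s v"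
    unfolding mixture_def
    by (intro sum_mono mult_left_mono mean_trim [OF increasing_nonneg_components assms]) simp
  finally show ?thesis .
qed

text \<open>All components share one bound at \<open>v\<close>, and the weights sum to less than
  \<open>1\<close>.\<close>

lemma mixture_bounded: "\<exists>C. \<forall>s. mixture s v \<le> C"
proof -
  obtain C where C: "\<And>Q s. increasing_nonneg Q \<Longrightarrow> trim Q s v \<le> C"
    using trim_bounded by blast
  have "0 \<le> C"
    using trim_nonneg C increasing_nonneg_components order_trans by blast
  have "mixture s v \<le> (\<Sum>e<s. (1/2) ^ Suc e * C)" for s
    unfolding mixture_def
    by (intro sum_mono mult_left_mono C increasing_nonneg_components) simp
  also have "(\<Sum>e<s. (1/2) ^ Suc e * C) = (1 - (1/2) ^ s) * C" for s
    by (simp only: sum_distrib_right [symmetric] sum_halves)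
  also have "\<dots> s \<le> C" for s
    using damping_bounds(2) [of s] \<open>0 \<le> C\<close> mult_right_mono [of "1 - (1/2) ^ s" 1 C] by simp
  finally show ?thesis by blast
qed

definition universal :: "situation \<Rightarrow> real" where
  "universal v = (SUP s. real_of_rat (mixture s v))"

lemma mixture_tendsto: "(\<lambda>s. real_of_rat (mixture s v)) \<longlonglongrightarrow> universal v"
  unfolding universal_def
proof (rule LIMSEQ_incseq_SUP)
  obtain C where "\<And>s. mixture s v \<le> C" using mixture_bounded by blast
  then show "bdd_above (range (\<lambda>s. real_of_rat (mixture s v)))"
    by (intro bdd_aboveI [of _ "real_of_rat C"]) (auto simp: of_rat_less_eq)
  show "incseq (\<lambda>s. real_of_rat (mixture s v))"
    by (intro incseq_SucI) (simp add: of_rat_less_eq mixture_mono)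
qed

lemma lower_semicomputable_universal: "lower_semicomputable situation_encode universal"
  unfolding lower_semicomputable_def
  using recursive_mixture mixture_mono mixture_tendsto by blast

text \<open>The mean is a finite linear combination of values, so the inequalities for
  \<open>mixture s\<close> pass to the limit.\<close>

lemma test_superfarthingale_universal: "test_superfarthingale universal"
  unfolding test_superfarthingale_def superfarthingale_iff
proof (intro conjI allI ballI)
  fix v I p assume p: "p \<in> ends I"
  have "(\<lambda>s. mean (real_of_rat p) (\<lambda>x. real_of_rat (mixture s (v @ [(I, x)]))))
      \<longlonglongrightarrow> mean (of_rat p) (\<lambda>x. universal (v @ [(I, x)]))"
    unfolding mean_def by (intro tendsto_intros mixture_tendsto)
  then show "mean (of_rat p) (\<lambda>x. universal (v @ [(I, x)])) \<le> universal v"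
    by (rule LIMSEQ_le [OF _ mixture_tendsto])
      (simp add: of_rat_mean [symmetric] of_rat_less_eq mean_mixture [OF p])
next
  fix v show "0 \<le> universal v"
    by (rule LIMSEQ_le_const [OF mixture_tendsto]) (simp add: mixture_nonneg)
next
  \<comment> \<open>At the root every component is \<open>1\<close>, so only the partial sum of the
    weights remains; it tends to \<open>1\<close>.\<close>
  have "mixture s [] = 1 - (1/2) ^ s" for s
    by (simp add: mixture_def sum_halves [simplified])
  then have "(\<lambda>s. 1 - (1/2) ^ s) \<longlonglongrightarrow> universal []"
    using mixture_tendsto [of "[]"] by (simp add: of_rat_diff of_rat_power of_rat_divide)
  moreover have "(\<lambda>s. 1 - (1/2 :: real) ^ s) \<longlonglongrightarrow> 1 - 0"
    by (intro tendsto_intros LIMSEQ_power_zero) simp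
  ultimately show "universal [] = 1"
    using LIMSEQ_unique by fastforce
qed

text \<open>The component \<open>e\<close> that converges to \<open>F\<close> has weight
  \<open>(1/2) ^ Suc e\<close>, whence \<open>c = 2 ^ Suc e\<close>. After an impossible outcome the
  component is \<open>0\<close>, which explains the restriction on \<open>v\<close>.\<close>

lemma universal_dominates:
  assumes "lower_semicomputable situation_encode F" "test_superfarthingale F"
  shows "\<exists>c>0. \<forall>v. list_all possible v \<longrightarrow> F v \<le> c * universal v"
proof -
  have F: "superfarthingale F" "\<And>v. 0 \<le> F v" "F [] = 1"
    using assms(2) by (auto simp: test_superfarthingale_def)
  obtain e where e: "\<And>v. (\<lambda>k. real_of_rat (approx e k v)) \<longlonglongrightarrow> F v"
    using approx_tendsto [OF assms(1) F(2)] by blast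
  have "(1/2) ^ Suc e * F v \<le> universal v" if "list_all possible v" for v
  proof (rule LIMSEQ_le [OF _ mixture_tendsto])
    show "(\<lambda>s. (1/2) ^ Suc e * real_of_rat (trim (damped (approx e)) s v)) \<longlonglongrightarrow> (1/2) ^ Suc e * F v"
      by (intro tendsto_intros trim_tendsto increasing_nonneg_approx e F that)
    have "(1/2) ^ Suc e * real_of_rat (trim (damped (approx e)) s v) \<le> real_of_rat (mixture s v)"
      if "s \<ge> Suc e" for s
    proof -
      have "real_of_rat ((1/2) ^ Suc e * trim (damped (approx e)) s v) \<le> real_of_rat (mixture s v)"
        unfolding of_rat_less_eq using that by (intro mixture_ge) simp
      then show ?thesis by (simp add: of_rat_mult of_rat_power of_rat_divide)
    qed
    then show "\<exists>N. \<forall>s\<ge>N. (1/2) ^ Suc e * real_of_rat (trim (damped (approx e)) s v)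
        \<le> real_of_rat (mixture s v)" by blast
  qed
  then show ?thesis
    by (intro exI [of _ "2 ^ Suc e"]) (simp add: field_simps)
qed

lemma limsup_finite_dominated:
  fixes f g :: "nat \<Rightarrow> real"
  assumes "limsup (\<lambda>n. ereal (g n)) < \<infinity>" "0 < c" "\<And>n. f n \<le> c * g n"
  shows "limsup (\<lambda>n. ereal (f n)) < \<infinity>"
proof -
  obtain B where "limsup (\<lambda>n. ereal (g n)) < ereal B"
    using ereal_dense2 [OF assms(1)] by blast
  then have "\<forall>\<^sub>F n in sequentially. ereal (g n) < ereal B"
    by (rule Limsup_lessD)
  then have "\<forall>\<^sub>F n in sequentially. ereal (f n) \<le> ereal (c * B)"
  proof eventually_elim
    case (elim n)
    then have "c * g n \<le> c * B" using assms(2) by simp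
    with assms(3) [of n] show ?case by simp
  qed
  then have "limsup (\<lambda>n. ereal (f n)) \<le> ereal (c * B)"
    by (rule Limsup_bounded)
  then show ?thesis by (rule le_less_trans) simp
qed

theorem theorem8:
  "\<exists>U :: situation \<Rightarrow> real. superfarthingale U \<and>
     (\<forall>\<upsilon> :: path. non_degenerate \<upsilon> \<longrightarrow>
        (game_random \<upsilon> \<longleftrightarrow> limsup (\<lambda>n. ereal (U (path_prefix \<upsilon> n))) < \<infinity>))"
proof (intro exI [of _ universal] conjI allI impI iffI)
  show "superfarthingale universal"
    using test_superfarthingale_universal by (simp add: test_superfarthingale_def)
next
  \<comment> \<open>\<open>universal\<close> is itself one of the maps over which game-randomness
    quantifies.\<close>
  fix \<upsilon> assume "game_random \<upsilon>"
  then show "limsup (\<lambda>n. ereal (universal (path_prefix \<upsilon> n))) < \<infinity>"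
    unfolding game_random_def
    using lower_semicomputable_universal test_superfarthingale_universal by blast
next
  fix \<upsilon> assume \<upsilon>: "non_degenerate \<upsilon>" "limsup (\<lambda>n. ereal (universal (path_prefix \<upsilon> n))) < \<infinity>"
  \<comment> \<open>Non-degeneracy places every prefix among the situations on which domination
    holds.\<close>
  have possible: "list_all possible (path_prefix \<upsilon> n)" for n
    using \<upsilon>(1) by (simp add: non_degenerate_def path_prefix_def possible_def list_all_iff)
  have "limsup (\<lambda>n. ereal (F (path_prefix \<upsilon> n))) < \<infinity>"
    if F: "lower_semicomputable situation_encode F" "test_superfarthingale F" for F
  proof -
    obtain c where "c > 0" "\<And>n. F (path_prefix \<upsilon> n) \<le> c * universal (path_prefix \<upsilon> n)"
      using universal_dominates [OF F] possible by blast
    then show ?thesis by (rule limsup_finite_dominated [OF \<upsilon>(2)])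
  qed
  with \<upsilon>(1) show "game_random \<upsilon>" by (simp add: game_random_def)
qed

end
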